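(* Let $2\le r_1<r_2$ be integers and let $n$ be such that $h_0:=n-5-2(r_1+r_2)\ge2$. Define on $\mathfrak{F}(n)$ the maps $\alpha([h,q_1,q_2])=[h-1,q_1+1,q_2]$ (for $h\ge3$), $\beta([h,q_1,q_2])=[h,q_1-1,q_2+1]$ (for $q_1\ge3$), and $\gamma([h,q_1,q_2])=[h-1,q_1,q_2+1]$ (for $h\ge3$). Let $T^*=[h_0,2,2]$. Then: (a) for each $T$ in the domain of $\alpha$ (resp. $\beta$, $\gamma$), the tree $\alpha(T)$ (resp. $\beta(T)$, $\gamma(T)$) is obtained from $T$ by a 2-switch; (b) $\rho(\alpha(T))<\rho(T)$, $\rho(\beta(T))<\rho(T)$ and $\rho(\gamma(T))<\rho(T)$ whenever defined; (c) every $T\in\mathfrak{F}(n)$ can be obtained from $T^*$ by a sequence of applications of $\alpha$ and $\beta$; (d) every $T\in\mathfrak{F}(n)$ can be obtained from $T^*$ by a sequence of applications of $\alpha$ and $\gamma$.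
   Context: $\rho(G)$ denotes the spectral radius (largest eigenvalue of the adjacency matrix) of a graph $G$. For integers $h,q_1,q_2\ge 2$ and fixed integers $2\le r_1<r_2$, the tree $[h,q_1,q_2]$ is constructed as follows: take a vertex $u$; attach to $u$ a pendant path with $h$ edges; attach to $u$ a path with $q_1$ edges ending at a vertex $v_1$, and attach to $v_1$ exactly $r_1$ pendant paths with $2$ edges each; attach to $u$ a path with $q_2$ edges ending at a vertex $v_2$, and attach to $v_2$ exactly $r_2$ pendant paths with $2$ edges each. It has $n=1+h+q_1+q_2+2(r_1+r_2)$ vertices. $\mathfrak{F}(n)$ is the set of all such trees $[h,q_1,q_2]$ with $h,q_1,q_2\ge2$ and $h+q_1+q_2=n-1-2(r_1+r_2)$. A 2-switch in a graph $G$ with distinct vertices $a,b,c,d$ such that $ab,cd\in E(G)$ and $ac,bd\notin E(G)$ consists of deleting $ab,cd$ and adding $ac,bd$. *)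

theory Defs
  imports Complex_Main
begin

text \<open>A finite simple graph is represented as a pair (V, E) of a vertex set
  V of naturals and a set E of edges, each edge being a 2-element set.\<close>
type_synonym graph = "nat set \<times> nat set set"

definition verts :: "graph \<Rightarrow> nat set" where "verts G = fst G"
definition edges :: "graph \<Rightarrow> nat set set" where "edges G = snd G"

definition adj :: "graph \<Rightarrow> nat \<Rightarrow> nat \<Rightarrow> real" where
  "adj G x y = (if {x, y} \<in> edges G then 1 else 0)"

definition is_eigenvalue :: "graph \<Rightarrow> real \<Rightarrow> bool" where
  "is_eigenvalue G mu \<longleftrightarrow>
     (\<exists>v :: nat \<Rightarrow> real. (\<exists>x\<in>verts G. v x \<noteq> 0) \<and>
        (\<forall>x\<in>verts G. (\<Sum>y\<in>verts G. adj G x y * v y) = mu * v x))"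

definition rho :: "graph \<Rightarrow> real" where
  "rho G = Max {mu. is_eigenvalue G mu}"

definition graph_iso :: "graph \<Rightarrow> graph \<Rightarrow> bool" where
  "graph_iso G H \<longleftrightarrow> (\<exists>f. bij_betw f (verts G) (verts H) \<and>
     (\<forall>x\<in>verts G. \<forall>y\<in>verts G. {x, y} \<in> edges G \<longleftrightarrow> {f x, f y} \<in> edges H))"

definition two_switch :: "graph \<Rightarrow> graph \<Rightarrow> bool" where
  "two_switch G H \<longleftrightarrow> (\<exists>a b c d.
     a \<in> verts G \<and> b \<in> verts G \<and> c \<in> verts G \<and> d \<in> verts G \<and>
     distinct [a, b, c, d] \<and>
     {a, b} \<in> edges G \<and> {c, d} \<in> edges G \<and> {a, c} \<notin> edges G \<and> {b, d} \<notin> edges G \<and>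
     graph_iso (verts G, (edges G - {{a, b}, {c, d}}) \<union> {{a, c}, {b, d}}) H)"

text \<open>Path with k edges hanging from vertex a, using new vertices s, s+1, ..., s+k-1
  (the path is a - s - s+1 - ... - s+k-1).\<close>
definition pedges :: "nat \<Rightarrow> nat \<Rightarrow> nat \<Rightarrow> nat set set" where
  "pedges a s k = (if 0 < k then {{a, s}} else {}) \<union> {{s + i, s + i + 1} | i. i + 1 < k}"

text \<open>The tree [h,q1,q2] (with parameters r1, r2): u = 0; pendant path 1..h;
  path h+1..h+q1 ending at v1 = h+q1; path h+q1+1..h+q1+q2 ending at v2 = h+q1+q2;
  r1 pendant paths of length 2 at v1, r2 pendant paths of length 2 at v2.\<close>
definition tree :: "nat \<Rightarrow> nat \<Rightarrow> nat \<times> nat \<times> nat \<Rightarrow> graph" where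
  "tree r1 r2 T = (case T of (h, q1, q2) \<Rightarrow>
     ({0..<1 + h + q1 + q2 + 2 * (r1 + r2)},
      pedges 0 1 h \<union> pedges 0 (h + 1) q1 \<union> pedges 0 (h + q1 + 1) q2
      \<union> (\<Union>i<r1. pedges (h + q1) (h + q1 + q2 + 1 + 2 * i) 2)
      \<union> (\<Union>i<r2. pedges (h + q1 + q2) (h + q1 + q2 + 1 + 2 * r1 + 2 * i) 2)))"

definition Fam :: "nat \<Rightarrow> nat \<Rightarrow> nat \<Rightarrow> (nat \<times> nat \<times> nat) set" where
  "Fam r1 r2 n = {(h, q1, q2). 2 \<le> h \<and> 2 \<le> q1 \<and> 2 \<le> q2 \<and>
      h + q1 + q2 = n - 1 - 2 * (r1 + r2)}"

fun alpha :: "nat \<times> nat \<times> nat \<Rightarrow> nat \<times> nat \<times> nat" where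
  "alpha (h, q1, q2) = (h - 1, q1 + 1, q2)"
fun beta :: "nat \<times> nat \<times> nat \<Rightarrow> nat \<times> nat \<times> nat" where
  "beta (h, q1, q2) = (h, q1 - 1, q2 + 1)"
fun gamma :: "nat \<times> nat \<times> nat \<Rightarrow> nat \<times> nat \<times> nat" where
  "gamma (h, q1, q2) = (h - 1, q1, q2 + 1)"

definition dom_alpha :: "nat \<Rightarrow> nat \<Rightarrow> nat \<Rightarrow> (nat \<times> nat \<times> nat) set" where
  "dom_alpha r1 r2 n = {T \<in> Fam r1 r2 n. 3 \<le> fst T}"
definition dom_beta :: "nat \<Rightarrow> nat \<Rightarrow> nat \<Rightarrow> (nat \<times> nat \<times> nat) set" where
  "dom_beta r1 r2 n = {T \<in> Fam r1 r2 n. 3 \<le> fst (snd T)}"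
definition dom_gamma :: "nat \<Rightarrow> nat \<Rightarrow> nat \<Rightarrow> (nat \<times> nat \<times> nat) set" where
  "dom_gamma r1 r2 n = {T \<in> Fam r1 r2 n. 3 \<le> fst T}"

definition step_ab :: "nat \<Rightarrow> nat \<Rightarrow> nat \<Rightarrow> ((nat \<times> nat \<times> nat) \<times> (nat \<times> nat \<times> nat)) set" where
  "step_ab r1 r2 n = {(T, alpha T) | T. T \<in> dom_alpha r1 r2 n}
                   \<union> {(T, beta T) | T. T \<in> dom_beta r1 r2 n}"
definition step_ag :: "nat \<Rightarrow> nat \<Rightarrow> nat \<Rightarrow> ((nat \<times> nat \<times> nat) \<times> (nat \<times> nat \<times> nat)) set" where
  "step_ag r1 r2 n = {(T, alpha T) | T. T \<in> dom_alpha r1 r2 n}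
                   \<union> {(T, gamma T) | T. T \<in> dom_gamma r1 r2 n}"

end

(*
  Let l be the spectral radius of [h,q1,q2] and s = l / (l^2 - 1), the response of a pendant path with
  two edges. Eliminating a positive eigenvector leg by leg towards u turns the eigenvalue equation into
    l = A + B + C,
  where A, B, C are obtained from 0, r1 s, r2 s by iterating x -> 1 / (l - x) along the legs h, q1, q2;
  a strict inequality l > A' + B' + C' for another tree of the family yields a positive vector that is
  strictly superharmonic at u only, so that the spectral radius of that tree is less than l.
  With this, alpha decreases the spectral radius iff A (A + C) < 1, and beta iff B (B + A) < 1. The
  first holds because the fixed point 1/t of the iteration (l = t + 1/t) separates A from B; the second
  by explicit bounds on A and B, which need q1 >= 3, q2 >= 2 and r2 >= r1 + 1. Moreover gamma = beta o alpha.
  Each move transposes u with a neighbour on a path, that is, it exchanges the parents of two vertices.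
*)
theory Submission
  imports Defs "HOL-Analysis.Function_Topology" "Jordan_Normal_Form.Char_Poly"
begin

section \<open>A nonnegative eigenvector for the spectral radius, by maximizing the Rayleigh
  quotient\<close>

section \<open>Perron vectors\<close>

definition bilin :: "(nat \<Rightarrow> nat \<Rightarrow> real) \<Rightarrow> nat set \<Rightarrow> (nat \<Rightarrow> real) \<Rightarrow> (nat \<Rightarrow> real) \<Rightarrow> real" where
  "bilin A V v w = (\<Sum>x\<in>V. v x * (\<Sum>y\<in>V. A x y * w y))"

lemma bilin_add_left: "bilin A V (\<lambda>x. v x + c * w x) z = bilin A V v z + c * bilin A V w z"
  by (simp add: bilin_def algebra_simps sum.distrib sum_distrib_left)

lemma bilin_add_right: "bilin A V z (\<lambda>x. v x + c * w x) = bilin A V z v + c * bilin A V z w"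
  by (simp add: bilin_def algebra_simps sum.distrib sum_distrib_left)

lemma bilin_sym:
  assumes "\<And>x y. A x y = A y x"
  shows "bilin A V v w = bilin A V w v"
proof -
  have "bilin A V v w = (\<Sum>x\<in>V. \<Sum>y\<in>V. v x * (A x y * w y))"
    by (simp add: bilin_def sum_distrib_left)
  also have "\<dots> = (\<Sum>y\<in>V. \<Sum>x\<in>V. v x * (A x y * w y))"
    by (rule sum.swap)
  also have "\<dots> = bilin A V w v"
    by (simp add: bilin_def sum_distrib_left assms[of _ _] ac_simps)
  finally show ?thesis .
qed

text \<open>Vectors are functions on all naturals, so the coordinates off \<open>V\<close> are
  pinned to 0. The sphere is then a closed subset of a product of factors [-1,1] and {0}, which is
  compact by Tychonoff.\<close>

lemma compact_unit_sphere:
  fixes V :: "nat set"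
  assumes "finite V"
  shows "compact {v :: nat \<Rightarrow> real. (\<forall>x. x \<notin> V \<longrightarrow> v x = 0) \<and> (\<Sum>x\<in>V. (v x)\<^sup>2) = 1}"
proof -
  let ?B = "PiE UNIV (\<lambda>x. if x \<in> V then {-1..1::real} else {0})"
  have "compactin (product_topology (\<lambda>_. euclidean) UNIV) ?B"
    by (subst compactin_PiE) auto
  then have "compact ?B"
    by (simp add: euclidean_product_topology)
  moreover have "closed {v :: nat \<Rightarrow> real. (\<Sum>x\<in>V. (v x)\<^sup>2) = 1}"
    by (intro closed_Collect_eq continuous_intros continuous_on_product_coordinates)
  ultimately have "compact (?B \<inter> {v. (\<Sum>x\<in>V. (v x)\<^sup>2) = 1})"
    by (rule compact_Int_closed)
  moreover have "?B \<inter> {v. (\<Sum>x\<in>V. (v x)\<^sup>2) = 1} =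
      {v. (\<forall>x. x \<notin> V \<longrightarrow> v x = 0) \<and> (\<Sum>x\<in>V. (v x)\<^sup>2) = 1}"
  proof -
    have bound: "-1 \<le> v x \<and> v x \<le> 1" if "(\<Sum>x\<in>V. (v x)\<^sup>2) = 1" "x \<in> V"
      for v :: "nat \<Rightarrow> real" and x
      using member_le_sum[of x V "\<lambda>x. (v x)\<^sup>2"] that assms
      by (simp add: abs_square_le_1 flip: abs_le_iff) (simp add: abs_le_iff)
    have "v \<in> ?B \<longleftrightarrow> (\<forall>x. x \<notin> V \<longrightarrow> v x = 0)"
      if "(\<Sum>x\<in>V. (v x)\<^sup>2) = 1" for v :: "nat \<Rightarrow> real"
      using bound[OF that] by (auto simp: PiE_iff)
    then show ?thesis by blast
  qed
  ultimately show ?thesis by simp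
qed

text \<open>By compactness the quadratic form has a maximizer on the unit sphere. As
  \<open>A\<close> is nonnegative, taking absolute values of the entries does not lower the form,
  and the first-order condition makes the resulting maximizer an eigenvector. The last conclusion
  later shows that its eigenvalue is the largest.\<close>

lemma rayleigh_maximizer:
  assumes "finite V" "V \<noteq> {}" and sym: "\<And>x y. A x y = A y x" and nonneg: "\<And>x y. 0 \<le> A x y"
  obtains v \<mu> where "\<And>x. 0 \<le> v x" "\<exists>x\<in>V. v x \<noteq> 0"
    "\<And>x. x \<in> V \<Longrightarrow> (\<Sum>y\<in>V. A x y * v y) = \<mu> * v x"
    "\<And>w. bilin A V w w \<le> \<mu> * (\<Sum>x\<in>V. (w x)\<^sup>2)"
proof -
  let ?S = "{v :: nat \<Rightarrow> real. (\<forall>x. x \<notin> V \<longrightarrow> v x = 0) \<and> (\<Sum>x\<in>V. (v x)\<^sup>2) = 1}"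
  obtain a where "a \<in> V" using assms by auto
  then have "(\<lambda>x. if x = a then 1 else 0) \<in> ?S"
    using assms by (auto simp: if_distrib[of "\<lambda>x. x\<^sup>2"] cong: if_cong)
  then have ne: "?S \<noteq> {}" by (metis (no_types, lifting) empty_iff)
  have "continuous_on ?S (\<lambda>v. bilin A V v v)"
    unfolding bilin_def
    by (intro continuous_intros 
      continuous_on_subset[OF continuous_on_product_coordinates subset_UNIV])
  from continuous_attains_sup[OF compact_unit_sphere[OF assms(1)] ne this]
  obtain u where u: "u \<in> ?S" and umax: "\<And>w. w \<in> ?S \<Longrightarrow> bilin A V w w \<le> bilin A V u u"
    by blast
  define v where "v = (\<lambda>x. \<bar>u x\<bar>)"
  define \<mu> where "\<mu> = bilin A V u u"
  \<comment> \<open>Homogeneity: a vector of nonzero norm is scaled to norm 1, and cutting it off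
    outside \<open>V\<close> affects neither the form nor the norm.\<close>
  have bound: "bilin A V w w \<le> \<mu> * (\<Sum>x\<in>V. (w x)\<^sup>2)" for w
  proof (cases "(\<Sum>x\<in>V. (w x)\<^sup>2) = 0")
    case True
    then have "\<And>x. x \<in> V \<Longrightarrow> w x = 0"
      using assms by (simp add: sum_nonneg_eq_0_iff)
    then show ?thesis by (simp add: bilin_def)
  next
    case False
    define N where "N = (\<Sum>x\<in>V. (w x)\<^sup>2)"
    have N: "N > 0" using False sum_nonneg[of V "\<lambda>x. (w x)\<^sup>2"] by (simp add: N_def less_le)
    define c where "c = 1 / sqrt N"
    have c: "c\<^sup>2 * N = 1" using N by (simp add: c_def power_divide)
    have "(\<Sum>x\<in>V. (if x \<in> V then c * w x else 0)\<^sup>2) = c\<^sup>2 * N"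
      unfolding N_def sum_distrib_left by (intro sum.cong) (simp_all add: power_mult_distrib)
    then have "(\<lambda>x. if x \<in> V then c * w x else 0) \<in> ?S"
      using c by simp
    from umax[OF this]
    have "bilin A V (\<lambda>x. if x \<in> V then c * w x else 0) (\<lambda>x. if x \<in> V then c * w x else 0) \<le> \<mu>"
      by (simp add: \<mu>_def)
    moreover have "bilin A V (\<lambda>x. if x \<in> V then c * w x else 0) (\<lambda>x. if x \<in> V then c * w x else 0) =
        c\<^sup>2 * bilin A V w w"
      unfolding bilin_def sum_distrib_left
      by (intro sum.cong) (simp_all add: power2_eq_square)
    ultimately have "N * (c\<^sup>2 * bilin A V w w) \<le> N * \<mu>"
      using N by (simp add: mult_left_mono)
    moreover have "N * (c\<^sup>2 * bilin A V w w) = (c\<^sup>2 * N) * bilin A V w w"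
      by (simp only: ac_simps)
    ultimately have "bilin A V w w \<le> N * \<mu>"
      using c by (metis mult_1)
    then show ?thesis
      by (simp add: N_def mult.commute)
  qed
  have "bilin A V u u \<le> bilin A V v v"
    unfolding bilin_def sum_distrib_left
  proof (intro sum_mono)
    fix x y
    have "u x * u y \<le> \<bar>u x\<bar> * \<bar>u y\<bar>" by (metis abs_ge_self abs_mult)
    from mult_left_mono[OF this nonneg[of x y]]
    show "u x * (A x y * u y) \<le> v x * (A x y * v y)"
      by (simp add: v_def algebra_simps)
  qed
  moreover have Nv: "(\<Sum>x\<in>V. (v x)\<^sup>2) = 1" using u by (simp add: v_def)
  ultimately have vmax: "bilin A V v v = \<mu>"
    using bound[of v] by (simp add: \<mu>_def)
  define g where "g x = (\<Sum>y\<in>V. A x y * v y) - \<mu> * v x" for x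
  define G where "G = (\<Sum>x\<in>V. (g x)\<^sup>2)"
  define c where "c = \<mu> * G - bilin A V g g"
  have G: "G = bilin A V g v - \<mu> * (\<Sum>x\<in>V. g x * v x)"
    unfolding G_def bilin_def sum_distrib_left[of \<mu>] sum_subtractf[symmetric]
  proof (intro sum.cong refl)
    fix x
    have "(g x)\<^sup>2 = g x * ((\<Sum>y\<in>V. A x y * v y) - \<mu> * v x)"
      by (simp add: power2_eq_square g_def)
    then show "(g x)\<^sup>2 = g x * (\<Sum>y\<in>V. A x y * v y) - \<mu> * (g x * v x)"
      by (simp only: right_diff_distrib mult.left_commute)
  qed
  \<comment> \<open>first-order condition at the maximizer, tested in the direction of the residual itself\<close>
  have Gle: "2 * e * G \<le> e\<^sup>2 * c" for e
  proof -
    have "bilin A V (\<lambda>x. v x + e * g x) (\<lambda>x. v x + e * g x) =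
        \<mu> + 2 * e * bilin A V g v + e\<^sup>2 * bilin A V g g"
      using bilin_sym[of A V v g, OF sym]
      by (simp add: bilin_add_left bilin_add_right vmax power2_eq_square algebra_simps)
    moreover have "(\<Sum>x\<in>V. (v x + e * g x)\<^sup>2) =
        1 + 2 * e * (\<Sum>x\<in>V. g x * v x) + e\<^sup>2 * G"
      unfolding Nv[symmetric] G_def sum_distrib_left[of _ _ V] sum.distrib[symmetric]
      by (intro sum.cong) (simp_all add: power2_eq_square algebra_simps)
    ultimately have "\<mu> + 2 * e * bilin A V g v + e\<^sup>2 * bilin A V g g \<le>
        \<mu> * (1 + 2 * e * (\<Sum>x\<in>V. g x * v x) + e\<^sup>2 * G)"
      using bound[of "\<lambda>x. v x + e * g x"] by simp
    moreover have "bilin A V g v = G + \<mu> * (\<Sum>x\<in>V. g x * v x)"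
      using G by simp
    ultimately show ?thesis
      by (simp add: c_def algebra_simps)
  qed
  have "G \<le> 0"
  proof (rule ccontr)
    assume "\<not> G \<le> 0"
    then have "G > 0" by simp
    \<comment> \<open>The step length e = G / (|c| + 1) is small enough that the quadratic term e^2
      * c is at most e * G, half of the linear term.\<close>
    have "2 * (G / (\<bar>c\<bar> + 1)) * G \<le> (G / (\<bar>c\<bar> + 1))\<^sup>2 * c" by (rule Gle)
    also have "\<dots> \<le> (G / (\<bar>c\<bar> + 1))\<^sup>2 * (\<bar>c\<bar> + 1)" by (intro mult_left_mono) auto
    also have "\<dots> = G / (\<bar>c\<bar> + 1) * G" by (simp add: power2_eq_square divide_simps) 
    finally have "G / (\<bar>c\<bar> + 1) * G \<le> 0" by simp
    moreover have "0 < G / (\<bar>c\<bar> + 1) * G" using \<open>G > 0\<close> by simp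
    ultimately show False by simp
  qed
  then have "\<And>x. x \<in> V \<Longrightarrow> g x = 0"
    using assms(1) sum_nonneg[of V "\<lambda>x. (g x)\<^sup>2"] by (auto simp: G_def sum_nonneg_eq_0_iff)
  then have eig: "\<And>x. x \<in> V \<Longrightarrow> (\<Sum>y\<in>V. A x y * v y) = \<mu> * v x" by (simp add: g_def)
  have "\<exists>x\<in>V. v x \<noteq> 0"
  proof (rule ccontr)
    assume "\<not> ?thesis"
    then have "(\<Sum>x\<in>V. (v x)\<^sup>2) = 0" by simp
    then show False using Nv by simp
  qed
  then show ?thesis
    by (intro that[of v \<mu>] eig bound) (simp add: v_def)
qed

lemma adj_sym: "adj G x y = adj G y x"
  by (simp add: adj_def insert_commute)

lemma is_eigenvalue_upto:
  assumes "verts G = {0..<N}"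
  shows "is_eigenvalue G mu \<longleftrightarrow>
    (\<exists>v. (\<exists>x<N. v x \<noteq> 0) \<and> (\<forall>x<N. (\<Sum>y<N. adj G x y * v y) = mu * v x))"
  by (auto simp: is_eigenvalue_def assms atLeast0LessThan)

text \<open>\<open>rho\<close> is a \<open>Max\<close>, which is meaningful only over a finite set.
  Eigenvalues are roots of the characteristic polynomial, which is monic and hence nonzero.\<close>

lemma finite_eigenvalues:
  assumes "verts G = {0..<N}"
  shows "finite {mu. is_eigenvalue G mu}"
proof -
  define A where "A = mat N N (\<lambda>(i, j). adj G i j)"
  have A: "A \<in> carrier_mat N N" by (simp add: A_def)
  have "eigenvalue A mu" if ev: "is_eigenvalue G mu" for mu
  proof -
    obtain v where ne: "\<exists>x<N. v x \<noteq> 0"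
      and eq: "\<And>x. x < N \<Longrightarrow> (\<Sum>y = 0..<N. adj G x y * v y) = mu * v x"
      using ev unfolding is_eigenvalue_upto[OF assms] atLeast0LessThan by blast
    have "vec N v \<noteq> 0\<^sub>v N"
      using ne by (metis index_vec index_zero_vec(1))
    moreover have "A *\<^sub>v vec N v = mu \<cdot>\<^sub>v vec N v"
      by (rule eq_vecI) (auto simp: A_def scalar_prod_def eq)
    ultimately have "eigenvector A (vec N v) mu"
      by (simp add: eigenvector_def A_def)
    then show ?thesis
      by (auto simp: eigenvalue_def)
  qed
  then have "{mu. is_eigenvalue G mu} \<subseteq> {mu. poly (char_poly A) mu = 0}"
    using eigenvalue_root_char_poly[OF A] by auto
  moreover have "char_poly A \<noteq> 0"
    using degree_monic_char_poly[OF A] by auto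
  ultimately show ?thesis
    using poly_roots_finite finite_subset by blast
qed

text \<open>The Rayleigh bound, tested on an eigenvector of any other eigenvalue, shows that the
  maximizer belongs to the largest one.\<close>

lemma rho_eigenvector:
  assumes V: "verts G = {0..<N}" and "0 < N"
  obtains v where "\<And>x. 0 \<le> v x" "\<exists>x<N. v x \<noteq> 0"
    "\<And>x. x < N \<Longrightarrow> (\<Sum>y<N. adj G x y * v y) = rho G * v x"
proof -
  have pos: "0 \<le> adj G x y" for x y by (simp add: adj_def)
  obtain v \<mu> where v: "\<And>x. 0 \<le> v x" "\<exists>x\<in>{..<N}. v x \<noteq> 0"
    and eig: "\<And>x. x \<in> {..<N} \<Longrightarrow> (\<Sum>y<N. adj G x y * v y) = \<mu> * v x"
    and bound: "\<And>w. bilin (adj G) {..<N} w w \<le> \<mu> * (\<Sum>x<N. (w x)\<^sup>2)"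
    using rayleigh_maximizer[of "{..<N}" "adj G"] assms(2) adj_sym pos by blast
  have "is_eigenvalue G \<mu>"
    using v eig by (auto simp: is_eigenvalue_def V atLeast0LessThan)
  moreover have "\<nu> \<le> \<mu>" if ev: "is_eigenvalue G \<nu>" for \<nu>
  proof -
    obtain w where w: "\<exists>x<N. w x \<noteq> 0"
      "\<And>x. x < N \<Longrightarrow> (\<Sum>y<N. adj G x y * w y) = \<nu> * w x"
      using ev unfolding is_eigenvalue_upto[OF V] by blast
    have "bilin (adj G) {..<N} w w = \<nu> * (\<Sum>x<N. (w x)\<^sup>2)"
      unfolding bilin_def sum_distrib_left[of \<nu>]
      by (intro sum.cong) (simp_all add: w(2) power2_eq_square)
    moreover have "(\<Sum>x<N. (w x)\<^sup>2) > 0"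
      using w(1) by (auto intro: sum_pos2)
    ultimately show ?thesis using bound[of w] by simp
  qed
  ultimately have "rho G = \<mu>"
    unfolding rho_def using finite_eigenvalues[OF V] by (intro Max_eqI) auto
  then show ?thesis using that v eig by auto
qed

section \<open>Rooted trees: positivity of Perron vectors, superharmonic test vectors, and
  2-switches\<close>

section \<open>Graphs given by a parent function\<close>

text \<open>A tree rooted at 0 is encoded by the parent of every other vertex. When parents carry
  smaller numbers than their children, arguments along the tree become inductions on the
  numbering.\<close>

definition pgraph :: "nat \<Rightarrow> (nat \<Rightarrow> nat) \<Rightarrow> graph" where
  "pgraph N p = ({0..<N}, (\<lambda>x. {p x, x}) ` {1..<N})"

lemma verts_pgraph [simp]: "verts (pgraph N p) = {0..<N}"
  by (simp add: pgraph_def verts_def)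

lemma pgraph_edge_iff:
  "{x, y} \<in> edges (pgraph N p) \<longleftrightarrow> 0 < y \<and> y < N \<and> p y = x \<or> 0 < x \<and> x < N \<and> p x = y"
  by (auto simp: pgraph_def edges_def doubleton_eq_iff image_iff Suc_le_eq)

definition nbr_sum :: "nat \<Rightarrow> (nat \<Rightarrow> nat) \<Rightarrow> (nat \<Rightarrow> real) \<Rightarrow> nat \<Rightarrow> real" where
  "nbr_sum N p v x = (if 0 < x then v (p x) else 0) + (\<Sum>y | 0 < y \<and> y < N \<and> p y = x. v y)"

text \<open>Since parents have smaller numbers, no vertex is both parent and child of
  \<open>x\<close>, so the two contributions do not overlap.\<close>

lemma pgraph_adj_sum:
  assumes par: "\<And>x. 0 < x \<Longrightarrow> x < N \<Longrightarrow> p x < x" and x: "x < N"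
  shows "(\<Sum>y<N. adj (pgraph N p) x y * v y) = nbr_sum N p v x"
proof -
  have "adj (pgraph N p) x y * v y =
      (if y = p x then if 0 < x then v y else 0 else 0) + (if 0 < y \<and> p y = x then v y else 0)"
    if "y < N" for y
    using par[of x] par[of y] that x by (auto simp: adj_def pgraph_edge_iff)
  then have "(\<Sum>y<N. adj (pgraph N p) x y * v y) =
      (\<Sum>y<N. if y = p x then if 0 < x then v y else 0 else 0) +
      (\<Sum>y<N. if 0 < y \<and> p y = x then v y else 0)"
    by (simp add: sum.distrib)
  also have "(\<Sum>y<N. if y = p x then if 0 < x then v y else 0 else 0) =
      (if 0 < x then v (p x) else 0)"
    using par[of x] x by (cases "0 < x") (auto simp: sum.delta)
  also have "(\<Sum>y<N. if 0 < y \<and> p y = x then v y else 0) = (\<Sum>y | 0 < y \<and> y < N \<and> p y = x. v y)"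
    by (simp add: sum.inter_filter[symmetric]) (intro sum.cong, auto)
  finally show ?thesis unfolding nbr_sum_def .
qed

text \<open>At a zero of a nonnegative eigenvector the neighbour sum vanishes, so all neighbours are
  zeros too. A single zero thus spreads to the root along parents and from there to every vertex,
  contradicting that the vector is nonzero.\<close>

lemma pgraph_perron:
  assumes par: "\<And>x. 0 < x \<Longrightarrow> x < N \<Longrightarrow> p x < x" and "0 < N"
  obtains v where "\<And>x. x < N \<Longrightarrow> 0 < v x"
    "\<And>x. x < N \<Longrightarrow> rho (pgraph N p) * v x = nbr_sum N p v x"
proof -
  obtain v where nonneg: "\<And>x. 0 \<le> v x" and ne: "\<exists>x<N. v x \<noteq> 0"
    and eq: "\<And>x. x < N \<Longrightarrow> (\<Sum>y<N. adj (pgraph N p) x y * v y) = rho (pgraph N p) * v x"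
    using rho_eigenvector[of "pgraph N p" N] assms(2) by auto
  have zero: "v x = 0 \<Longrightarrow> {x, y} \<in> edges (pgraph N p) \<Longrightarrow> x < N \<Longrightarrow> y < N \<Longrightarrow> v y = 0" for x y
  proof -
    assume *: "v x = 0" "{x, y} \<in> edges (pgraph N p)" "x < N" "y < N"
    have "\<forall>y\<in>{..<N}. adj (pgraph N p) x y * v y = 0"
      using eq[of x] * nonneg
      by (subst sum_nonneg_eq_0_iff[symmetric]) (auto simp: adj_def)
    then have "adj (pgraph N p) x y * v y = 0" using *(4) by blast
    then show "v y = 0" using *(2) by (simp add: adj_def)
  qed
  have edge: "{p x, x} \<in> edges (pgraph N p) \<and> {x, p x} \<in> edges (pgraph N p) \<and> p x < N"
    if "0 < x" "x < N" for x
    using par[OF that] that by (auto simp: pgraph_edge_iff)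
  have down: "v x = 0 \<Longrightarrow> x < N \<Longrightarrow> v 0 = 0" for x
  proof (induction x rule: less_induct)
    case (less x)
    then show ?case
      using zero[of x "p x"] edge[of x] par[of x] by (cases "x = 0") auto
  qed
  have up: "v 0 = 0 \<Longrightarrow> x < N \<Longrightarrow> v x = 0" for x
  proof (induction x rule: less_induct)
    case (less x)
    then show ?case
      using zero[of "p x" x] edge[of x] par[of x] by (cases "x = 0") auto
  qed
  have "0 < v x" if "x < N" for x
    using down[of x] up ne nonneg[of x] that by (metis less_eq_real_def)
  moreover have "rho (pgraph N p) * v x = nbr_sum N p v x" if "x < N" for x
    using eq[OF that] pgraph_adj_sum[OF par that, of v] by simp
  ultimately show ?thesis using that by blast
qed

text \<open>Pairing the superharmonic \<open>v\<close> with a positive Perron vector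
  \<open>w\<close> gives, by symmetry of the adjacency matrix, rho * <v,w> = <w, A v> < l * <v,w>;
  the strict inequality at \<open>z\<close> survives because \<open>w z\<close> is positive.\<close>

lemma rho_pgraph_less:
  assumes par: "\<And>x. 0 < x \<Longrightarrow> x < N \<Longrightarrow> p x < x"
    and pos: "\<And>x. x < N \<Longrightarrow> 0 < v x"
    and super: "\<And>x. x < N \<Longrightarrow> nbr_sum N p v x \<le> l * v x"
    and strict: "z < N" "nbr_sum N p v z < l * v z"
  shows "rho (pgraph N p) < l"
proof -
  let ?G = "pgraph N p"
  obtain w where wpos: "\<And>x. x < N \<Longrightarrow> 0 < w x"
    and w: "\<And>x. x < N \<Longrightarrow> rho ?G * w x = nbr_sum N p w x"
    by (rule pgraph_perron[of N p]) (use par strict(1) in auto)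
  have "rho ?G * (\<Sum>x<N. v x * w x) = bilin (adj ?G) {..<N} v w"
    unfolding bilin_def sum_distrib_left[of "rho ?G"]
    by (intro sum.cong) (simp_all add: pgraph_adj_sum par w[symmetric])
  also have "\<dots> = bilin (adj ?G) {..<N} w v"
    by (rule bilin_sym) (rule adj_sym)
  also have "\<dots> < (\<Sum>x<N. w x * (l * v x))"
    unfolding bilin_def
  proof (intro sum_strict_mono_ex1 ballI bexI)
    show "w z * (\<Sum>y<N. adj ?G z y * v y) < w z * (l * v z)"
      using strict by (simp add: pgraph_adj_sum par wpos)
  qed (use super strict in \<open>simp_all add: pgraph_adj_sum par wpos less_imp_le mult_left_mono\<close>)
  also have "\<dots> = l * (\<Sum>x<N. v x * w x)"
    unfolding sum_distrib_left by (intro sum.cong) simp_all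
  finally have "rho ?G * (\<Sum>x<N. v x * w x) < l * (\<Sum>x<N. v x * w x)" .
  moreover have "0 \<le> (\<Sum>x<N. v x * w x)"
    by (intro sum_nonneg) (simp add: pos wpos less_imp_le)
  ultimately show ?thesis
    by (meson mult_right_mono not_le)
qed

definition swap_parents :: "nat \<Rightarrow> nat \<Rightarrow> (nat \<Rightarrow> nat) \<Rightarrow> nat \<Rightarrow> nat" where
  "swap_parents a d p = p(a := p d, d := p a)"

text \<open>Exchanging the parents of \<open>a\<close> and \<open>d\<close> is the 2-switch on the
  vertices \<open>a\<close>, \<open>p a\<close>, \<open>p d\<close>, \<open>d\<close>. The bijection
  \<open>f\<close> fixes the root and carries the new parent function to \<open>p'\<close>, which
  yields the isomorphism that \<open>two_switch\<close> asks for.\<close>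

lemma pgraph_two_switch:
  assumes par: "\<And>x. 0 < x \<Longrightarrow> x < N \<Longrightarrow> p x < x"
    and a: "0 < a" "a < N" and d: "0 < d" "d < N" and dist: "a \<noteq> d" "p a \<noteq> p d" "p a \<noteq> d" "a \<noteq> p d"
    and nonedge: "p d \<noteq> 0 \<Longrightarrow> p (p d) \<noteq> a" "p a \<noteq> 0 \<Longrightarrow> p (p a) \<noteq> d"
    and f: "bij_betw f {0..<N} {0..<N}" "f 0 = 0"
    and fp: "\<And>x. 0 < x \<Longrightarrow> x < N \<Longrightarrow> p' (f x) = f (swap_parents a d p x)"
  shows "two_switch (pgraph N p) (pgraph N p')"
proof -
  let ?q = "swap_parents a d p"
  have q: "?q x < N" if "0 < x" "x < N" for x
    using par[OF that] par[OF a] par[OF d] that a d by (auto simp: swap_parents_def)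
  have edges: "(edges (pgraph N p) - {{a, p a}, {p d, d}}) \<union> {{a, p d}, {p a, d}} =
      (\<lambda>x. {?q x, x}) ` {1..<N}" (is "?L = ?R")
  proof
    show "?L \<subseteq> ?R"
    proof
      fix e assume "e \<in> ?L"
      show "e \<in> ?R"
      proof (cases "e = {a, p d} \<or> e = {p a, d}")
        case True
        moreover have "{a, p d} \<in> ?R"
          by (rule image_eqI[of _ _ a]) (use a dist in \<open>auto simp: swap_parents_def\<close>)
        moreover have "{p a, d} \<in> ?R"
          by (rule image_eqI[of _ _ d]) (use d dist in \<open>auto simp: swap_parents_def\<close>)
        ultimately show ?thesis by metis
      next
        case False
        then have "e \<in> edges (pgraph N p)" and ne: "e \<noteq> {a, p a}" "e \<noteq> {p d, d}"
          using \<open>e \<in> ?L\<close> by simp_all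
        then have "e \<in> (\<lambda>x. {p x, x}) ` {1..<N}"
          by (simp add: pgraph_def edges_def)
        then obtain x where x: "e = {p x, x}" "x \<in> {1..<N}"
          by (rule imageE)
        have "x \<noteq> a" "x \<noteq> d" using x ne by (auto simp: insert_commute)
        then have "?q x = p x" by (simp add: swap_parents_def)
        then show ?thesis using x by (intro image_eqI[of _ _ x]) simp_all
      qed
    qed
    show "?R \<subseteq> ?L"
    proof
      fix e assume "e \<in> ?R"
      then obtain x where x: "e = {?q x, x}" "1 \<le> x" "x < N" by auto
      show "e \<in> ?L"
      proof (cases "x = a \<or> x = d")
        case True
        then show ?thesis using x dist by (auto simp: swap_parents_def)
      next
        case False
        then have "e = {p x, x}" using x by (simp add: swap_parents_def)
        moreover have "{p x, x} \<noteq> {a, p a}" "{p x, x} \<noteq> {p d, d}"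
          using False par[of x] par[OF a] par[OF d] x by (auto simp: doubleton_eq_iff)
        ultimately show ?thesis using x by (auto simp: pgraph_def edges_def)
      qed
    qed
  qed
  have inj: "f x = f y \<longleftrightarrow> x = y" if "x < N" "y < N" for x y
    using f(1) that by (auto simp: bij_betw_def inj_on_def)
  have lt: "f x < N" if "x < N" for x
    using f(1) that by (auto simp: bij_betw_def)
  have pos: "0 < f x \<longleftrightarrow> 0 < x" if "x < N" for x
    using inj[of x 0] that f(2) by (metis gr0I not_less0)
  have "{x, y} \<in> (\<lambda>x. {?q x, x}) ` {1..<N} \<longleftrightarrow> {f x, f y} \<in> edges (pgraph N p')"
    if "x < N" "y < N" for x y
  proof -
    have "{x, y} \<in> (\<lambda>x. {?q x, x}) ` {1..<N} \<longleftrightarrow> {x, y} \<in> edges (pgraph N ?q)"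
      by (simp add: pgraph_def edges_def)
    then show ?thesis
      using that inj[OF q[of x] that(2)] inj[OF q[of y] that(1)]
      by (auto simp: pgraph_edge_iff fp lt pos)
  qed
  then have iso: "graph_iso (verts (pgraph N p), ?L) (pgraph N p')"
    unfolding graph_iso_def edges using f(1) by (auto simp: verts_def[of "(_, _)"] edges_def[of "(_, _)"])
  have "{a, p a} \<in> edges (pgraph N p)" "{p d, d} \<in> edges (pgraph N p)"
    using a d by (auto simp: pgraph_edge_iff)
  moreover have "{a, p d} \<notin> edges (pgraph N p)" "{p a, d} \<notin> edges (pgraph N p)"
    using nonedge dist by (auto simp: pgraph_edge_iff)
  moreover have "distinct [a, p a, p d, d]"
    using dist par[OF a] par[OF d] by auto
  moreover have "a \<in> verts (pgraph N p)" "p a \<in> verts (pgraph N p)"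
      "p d \<in> verts (pgraph N p)" "d \<in> verts (pgraph N p)"
    using a d par[OF a] par[OF d] by auto
  ultimately show ?thesis
    unfolding two_switch_def using iso by meson
qed

section \<open>The trees [h,q1,q2] as parent functions, and part (a)\<close>

section \<open>The trees and their 2-switches\<close>

text \<open>The three legs start at 1, h+1 and h+q1+1. Beyond h+q1+q2 the pendant paths occupy
  consecutive pairs: an odd offset is the vertex next to the hub, an even offset the leaf, and the
  first \<open>r1\<close> pairs belong to v1 = h+q1.\<close>

definition tree_par :: "nat \<Rightarrow> nat \<Rightarrow> nat \<Rightarrow> nat \<Rightarrow> nat \<Rightarrow> nat" where
  "tree_par r1 h q1 q2 x =
    (if x = 1 \<or> x = h + 1 \<or> x = h + q1 + 1 then 0
     else if x \<le> h + q1 + q2 \<or> even (x - (h + q1 + q2)) then x - 1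
     else if x \<le> h + q1 + q2 + 2 * r1 then h + q1 else h + q1 + q2)"

lemma tree_par_less:
  assumes "1 \<le> h" "1 \<le> q1" "1 \<le> q2" "0 < x"
  shows "tree_par r1 h q1 q2 x < x"
  using assms by (auto simp: tree_par_def)

lemma tree_par_low:
  "x \<le> h + q1 + q2 \<Longrightarrow>
    tree_par r1 h q1 q2 x = (if x = 1 \<or> x = h + 1 \<or> x = h + q1 + 1 then 0 else x - 1)"
  by (auto simp: tree_par_def)

lemma tree_par_high:
  assumes "h + q1 + q2 < x" "1 \<le> h" "1 \<le> q1" "1 \<le> q2"
  shows "tree_par r1 h q1 q2 x =
    (if even (x - (h + q1 + q2)) then x - 1
     else if x \<le> h + q1 + q2 + 2 * r1 then h + q1 else h + q1 + q2)"
  using assms by (auto simp: tree_par_def)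

lemma edges_leg:
  assumes "1 \<le> k" "1 \<le> s"
    and "\<And>x. s \<le> x \<Longrightarrow> x < s + k \<Longrightarrow> p x = (if x = s then a else x - 1)"
  shows "pedges a s k = (\<lambda>x. {p x, x}) ` {s..<s + k}"
proof
  show "pedges a s k \<subseteq> (\<lambda>x. {p x, x}) ` {s..<s + k}"
  proof
    fix e assume "e \<in> pedges a s k"
    then consider "e = {a, s}" | i where "e = {s + i, s + i + 1}" "i + 1 < k"
      by (auto simp: pedges_def split: if_splits)
    then show "e \<in> (\<lambda>x. {p x, x}) ` {s..<s + k}"
    proof cases
      case 1
      then show ?thesis using assms(1) assms(3)[of s] by (intro image_eqI[of _ _ s]) auto
    next
      case 2
      then show ?thesis using assms(3)[of "s + i + 1"] by (intro image_eqI[of _ _ "s + i + 1"]) auto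
    qed
  qed
  show "(\<lambda>x. {p x, x}) ` {s..<s + k} \<subseteq> pedges a s k"
  proof (rule image_subsetI)
    fix x assume x: "x \<in> {s..<s + k}"
    show "{p x, x} \<in> pedges a s k"
    proof (cases "x = s")
      case True
      then show ?thesis using assms(1) assms(3)[of s] by (simp add: pedges_def)
    next
      case False
      then have "{p x, x} = {s + (x - s - 1), s + (x - s - 1) + 1}" "x - s - 1 + 1 < k"
        using x assms(3)[of x] by auto
      then show ?thesis unfolding pedges_def by blast
    qed
  qed
qed

lemma atLeastLessThan_pairs:
  "{m..<m + 2 * r} = (\<Union>i<r. {m + 2 * i..<m + 2 * i + (2::nat)})"
proof
  show "{m..<m + 2 * r} \<subseteq> (\<Union>i<r. {m + 2 * i..<m + 2 * i + (2::nat)})"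
  proof
    fix x assume "x \<in> {m..<m + 2 * r}"
    then have "(x - m) div 2 < r" "x \<in> {m + 2 * ((x - m) div 2)..<m + 2 * ((x - m) div 2) + 2}"
      by auto
    then show "x \<in> (\<Union>i<r. {m + 2 * i..<m + 2 * i + (2::nat)})" by blast
  qed
qed auto

text \<open>Each family of paths in \<open>tree\<close> consists of the parent edges of one interval
  of vertices, and these intervals together cover all vertices except the root.\<close>

lemma tree_eq_pgraph:
  assumes "1 \<le> h" "1 \<le> q1" "1 \<le> q2"
  shows "tree r1 r2 (h, q1, q2) =
    pgraph (1 + h + q1 + q2 + 2 * (r1 + r2)) (tree_par r1 h q1 q2)"
proof -
  let ?p = "tree_par r1 h q1 q2"
  let ?e = "\<lambda>x. {?p x, x}"
  define s where "s = h + q1 + q2 + 1"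
  have "pedges 0 1 h = ?e ` {1..<1 + h}"
    using assms by (intro edges_leg) (auto simp: tree_par_def)
  moreover have "pedges 0 (h + 1) q1 = ?e ` {h + 1..<h + 1 + q1}"
    using assms by (intro edges_leg) (auto simp: tree_par_def)
  moreover have "pedges 0 (h + q1 + 1) q2 = ?e ` {h + q1 + 1..<h + q1 + 1 + q2}"
    using assms by (intro edges_leg) (auto simp: tree_par_def)
  moreover have "(\<Union>i<r1. pedges (h + q1) (s + 2 * i) 2) = ?e ` {s..<s + 2 * r1}"
  proof -
    have "pedges (h + q1) (s + 2 * i) 2 = ?e ` {s + 2 * i..<s + 2 * i + 2}" if "i < r1" for i
    proof (rule edges_leg)
      fix x assume "s + 2 * i \<le> x" "x < s + 2 * i + 2"
      then have "x = s + 2 * i \<or> x = s + 2 * i + 1" by auto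
      then show "?p x = (if x = s + 2 * i then h + q1 else x - 1)"
        using that assms by (auto simp: tree_par_def s_def)
    qed (use assms in \<open>auto simp: s_def\<close>)
    then show ?thesis unfolding atLeastLessThan_pairs image_UN by auto
  qed
  moreover have "(\<Union>i<r2. pedges (h + q1 + q2) (s + 2 * r1 + 2 * i) 2) =
      ?e ` {s + 2 * r1..<s + 2 * r1 + 2 * r2}"
  proof -
    have "pedges (h + q1 + q2) (s + 2 * r1 + 2 * i) 2 =
        ?e ` {s + 2 * r1 + 2 * i..<s + 2 * r1 + 2 * i + 2}" if "i < r2" for i
    proof (rule edges_leg)
      fix x assume "s + 2 * r1 + 2 * i \<le> x" "x < s + 2 * r1 + 2 * i + 2"
      then have "x = s + 2 * r1 + 2 * i \<or> x = s + 2 * r1 + 2 * i + 1" by auto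
      then show "?p x = (if x = s + 2 * r1 + 2 * i then h + q1 + q2 else x - 1)"
        using that assms by (auto simp: tree_par_def s_def)
    qed (use assms in \<open>auto simp: s_def\<close>)
    then show ?thesis unfolding atLeastLessThan_pairs image_UN by auto
  qed
  moreover have "{1..<1 + h + q1 + q2 + 2 * (r1 + r2)} = {1..<1 + h} \<union> {h + 1..<h + 1 + q1} \<union>
      {h + q1 + 1..<h + q1 + 1 + q2} \<union> {s..<s + 2 * r1} \<union> {s + 2 * r1..<s + 2 * r1 + 2 * r2}"
    by (auto simp: s_def)
  ultimately show ?thesis
    unfolding tree_def pgraph_def s_def by (simp only: image_Un prod.case)
qed

text \<open>The cyclic shift of the block from \<open>a\<close> to \<open>b\<close>. It restores the
  leg-by-leg numbering after vertex \<open>a\<close> has moved from the start of one leg to the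
  start of a later one.\<close>

definition rotate_down :: "nat \<Rightarrow> nat \<Rightarrow> nat \<Rightarrow> nat" where
  "rotate_down a b x = (if x = a then b else if a < x \<and> x \<le> b then x - 1 else x)"

lemma bij_betw_rotate_down:
  assumes "a \<le> b" "b < N"
  shows "bij_betw (rotate_down a b) {0..<N} {0..<N}"
proof (rule bij_betw_byWitness)
  let ?g = "\<lambda>x. if x = b then a else if a \<le> x \<and> x < b then x + 1 else x"
  show "\<forall>x\<in>{0..<N}. ?g (rotate_down a b x) = x"
    using assms by (auto simp: rotate_down_def)
  show "\<forall>x\<in>{0..<N}. rotate_down a b (?g x) = x"
    using assms by (auto simp: rotate_down_def)
  show "rotate_down a b ` {0..<N} \<subseteq> {0..<N}"
    using assms by (auto simp: rotate_down_def)
  show "?g ` {0..<N} \<subseteq> {0..<N}"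
    using assms by auto
qed

text \<open>Vertices 2 and h+1 exchange their parents 1 and 0: the pendant leg now begins at 2, and
  vertex 1 becomes the first vertex of the q1-leg, where the new numbering calls it
  \<open>h\<close>.\<close>

lemma two_switch_alpha:
  assumes "3 \<le> h" "2 \<le> q1" "2 \<le> q2"
  shows "two_switch (tree r1 r2 (h, q1, q2)) (tree r1 r2 (h - 1, q1 + 1, q2))"
proof -
  let ?N = "1 + h + q1 + q2 + 2 * (r1 + r2)"
  obtain k where k: "h = Suc k" using assms by (cases h) auto
  have "two_switch (pgraph ?N (tree_par r1 h q1 q2)) (pgraph ?N (tree_par r1 (h - 1) (q1 + 1) q2))"
  proof (rule pgraph_two_switch[where a = 2 and d = "h + 1" and f = "rotate_down 1 h"])
    fix x assume "0 < x" "x < ?N"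
    then consider "x = 1" |
      "x = 2" |
      "3 \<le> x \<and> x \<le> h" |
      "x = h + 1" |
      "h + 2 \<le> x \<and> x \<le> h + q1" |
      "x = h + q1 + 1" |
      "h + q1 + 2 \<le> x \<and> x \<le> h + q1 + q2" |
      "h + q1 + q2 < x"
      by linarith
    then show "tree_par r1 (h - 1) (q1 + 1) q2 (rotate_down 1 h x) =
        rotate_down 1 h (swap_parents 2 (h + 1) (tree_par r1 h q1 q2) x)"
      by cases (use assms in \<open>auto simp: k tree_par_low tree_par_high rotate_down_def swap_parents_def\<close>)
  qed (use assms in \<open>auto simp: k tree_par_less tree_par_low rotate_down_def
      intro!: bij_betw_rotate_down\<close>)
  then show ?thesis
    using assms by (simp add: tree_eq_pgraph)
qed

text \<open>Here h+1, the first vertex of the q1-leg, is moved to the start of the q2-leg.\<close>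

lemma two_switch_beta:
  assumes "2 \<le> h" "3 \<le> q1" "2 \<le> q2"
  shows "two_switch (tree r1 r2 (h, q1, q2)) (tree r1 r2 (h, q1 - 1, q2 + 1))"
proof -
  let ?N = "1 + h + q1 + q2 + 2 * (r1 + r2)"
  obtain k where k: "q1 = Suc k" using assms by (cases q1) auto
  have "two_switch (pgraph ?N (tree_par r1 h q1 q2)) (pgraph ?N (tree_par r1 h (q1 - 1) (q2 + 1)))"
  proof (rule pgraph_two_switch[where a = "h + 2" and d = "h + q1 + 1" and f = "rotate_down (h + 1) (h + q1)"])
    fix x assume "0 < x" "x < ?N"
    then consider "x = 1" |
      "2 \<le> x \<and> x \<le> h" |
      "x = h + 1" |
      "x = h + 2" |
      "h + 3 \<le> x \<and> x \<le> h + q1" |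
      "x = h + q1 + 1" |
      "h + q1 + 2 \<le> x \<and> x \<le> h + q1 + q2" |
      "h + q1 + q2 < x"
      by linarith
    then show "tree_par r1 h (q1 - 1) (q2 + 1) (rotate_down (h + 1) (h + q1) x) =
        rotate_down (h + 1) (h + q1) (swap_parents (h + 2) (h + q1 + 1) (tree_par r1 h q1 q2) x)"
      by cases (use assms in \<open>auto simp: k tree_par_low tree_par_high rotate_down_def swap_parents_def\<close>)
  qed (use assms in \<open>auto simp: k tree_par_less tree_par_low rotate_down_def
      intro!: bij_betw_rotate_down\<close>)
  then show ?thesis
    using assms by (simp add: tree_eq_pgraph)
qed

text \<open>Although gamma is a composition of two moves, one switch suffices: vertex 1 passes
  directly from the pendant leg to the q2-leg, so the renumbering rotates the whole q1-leg as
  well.\<close>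

lemma two_switch_gamma:
  assumes "3 \<le> h" "2 \<le> q1" "2 \<le> q2"
  shows "two_switch (tree r1 r2 (h, q1, q2)) (tree r1 r2 (h - 1, q1, q2 + 1))"
proof -
  let ?N = "1 + h + q1 + q2 + 2 * (r1 + r2)"
  obtain k where k: "h = Suc k" using assms by (cases h) auto
  have "two_switch (pgraph ?N (tree_par r1 h q1 q2)) (pgraph ?N (tree_par r1 (h - 1) q1 (q2 + 1)))"
  proof (rule pgraph_two_switch[where a = 2 and d = "h + q1 + 1" and f = "rotate_down 1 (h + q1)"])
    fix x assume "0 < x" "x < ?N"
    then consider "x = 1" |
      "x = 2" |
      "3 \<le> x \<and> x \<le> h" |
      "x = h + 1" |
      "h + 2 \<le> x \<and> x \<le> h + q1" |
      "x = h + q1 + 1" |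
      "h + q1 + 2 \<le> x \<and> x \<le> h + q1 + q2" |
      "h + q1 + q2 < x"
      by linarith
    then show "tree_par r1 (h - 1) q1 (q2 + 1) (rotate_down 1 (h + q1) x) =
        rotate_down 1 (h + q1) (swap_parents 2 (h + q1 + 1) (tree_par r1 h q1 q2) x)"
      by cases (use assms in \<open>auto simp: k tree_par_low tree_par_high rotate_down_def swap_parents_def\<close>)
  qed (use assms in \<open>auto simp: k tree_par_less tree_par_low rotate_down_def
      intro!: bij_betw_rotate_down\<close>)
  then show ?thesis
    using assms by (simp add: tree_eq_pgraph)
qed

section \<open>Elimination along legs and the inequalities behind alpha and beta\<close>

section \<open>Responses of a leg\<close>

text \<open>For a leg with \<open>k\<close> edges carrying an eigenvector for \<open>l\<close>, \<open>resp l b k\<close> is the quotient of its first two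
  entries, starting at the attached end, when the pendant paths at the far end contribute \<open>b\<close> times the
  far entry.\<close>

primrec resp :: "real \<Rightarrow> real \<Rightarrow> nat \<Rightarrow> real" where
  "resp l b 0 = b"
| "resp l b (Suc k) = 1 / (l - resp l b k)"

text \<open>Elimination starts at the far end: the last equation reads (l - b) * f m = f (m - 1),
  and each inner equation turns into the same form with the current response instead of
  \<open>b\<close>. Positivity of \<open>f\<close> keeps the denominators nonzero.\<close>

lemma resp_of_leg:
  fixes f :: "nat \<Rightarrow> real"
  assumes pos: "\<And>k. k \<le> m \<Longrightarrow> 0 < f k"
    and inner: "\<And>k. 0 < k \<Longrightarrow> k < m \<Longrightarrow> l * f k = f (k - 1) + f (k + 1)"
    and last: "l * f m = f (m - 1) + b * f m"
    and k: "k < m"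
  shows "f (m - k) = resp l b (Suc k) * f (m - Suc k)"
  using k
proof (induction k)
  case 0
  then have "(l - b) * f m = f (m - 1)" "0 < f (m - 1)"
    using last pos[of "m - 1"] by (simp_all add: algebra_simps)
  then have "l - b \<noteq> 0" by auto
  then show ?case using \<open>(l - b) * f m = f (m - 1)\<close> by (simp add: field_simps)
next
  case (Suc k)
  define j where "j = m - Suc k"
  have j: "m - k = j + 1" "m - Suc (Suc k) = j - 1" "0 < j" "j < m"
    using Suc.prems by (auto simp: j_def)
  have "f (j + 1) = resp l b (Suc k) * f j"
    using Suc j by (simp add: j_def)
  then have eq: "(l - resp l b (Suc k)) * f j = f (j - 1)"
    using inner[of j] j by (simp add: algebra_simps)
  moreover have "0 < f (j - 1)" using pos[of "j - 1"] j by simp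
  ultimately have "l - resp l b (Suc k) \<noteq> 0" by auto
  then have "f j = resp l b (Suc (Suc k)) * f (j - 1)"
    unfolding resp.simps(2)[of l b "Suc k"] eq[symmetric] by simp
  then show ?case
    using j by (simp only: j_def[symmetric])
qed

lemma resp_pos_of_leg:
  fixes f :: "nat \<Rightarrow> real"
  assumes pos: "\<And>k. k \<le> m \<Longrightarrow> 0 < f k"
    and inner: "\<And>k. 0 < k \<Longrightarrow> k < m \<Longrightarrow> l * f k = f (k - 1) + f (k + 1)"
    and last: "l * f m = f (m - 1) + b * f m"
    and k: "k \<in> {1..m}"
  shows "0 < resp l b k"
proof -
  have "f (m - (k - 1)) = resp l b (Suc (k - 1)) * f (m - Suc (k - 1))"
    using k by (intro resp_of_leg assms) auto
  moreover have "0 < f (m - (k - 1))" "0 < f (m - Suc (k - 1))"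
    by (simp_all add: pos)
  ultimately have "0 < resp l b (Suc (k - 1))"
    by (simp add: zero_less_mult_iff del: resp.simps)
  then show ?thesis using k by (simp del: resp.simps)
qed

text \<open>Converse of the elimination: the entry at distance \<open>k\<close> from the attached
  end, normalized to 1 there, as a product of successive ratios.\<close>

definition leg_vec :: "real \<Rightarrow> real \<Rightarrow> nat \<Rightarrow> nat \<Rightarrow> real" where
  "leg_vec l b m k = (\<Prod>i<k. resp l b (m - i))"

lemma leg_vec_0 [simp]: "leg_vec l b m 0 = 1"
  by (simp add: leg_vec_def)

lemma leg_vec_1 [simp]: "leg_vec l b m (Suc 0) = resp l b m"
  by (simp add: leg_vec_def)

lemma leg_vec_pos:
  assumes "\<And>k. k \<in> {1..m} \<Longrightarrow> 0 < resp l b k" "k \<le> m"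
  shows "0 < leg_vec l b m k"
  unfolding leg_vec_def using assms by (intro prod_pos) auto

lemma leg_vec_eq:
  assumes pos: "\<And>k. k \<in> {1..m} \<Longrightarrow> 0 < resp l b k" and k: "0 < k" "k \<le> m"
  shows "l * leg_vec l b m k = leg_vec l b m (k - 1) + resp l b (m - k) * leg_vec l b m k"
proof -
  define j where "j = m - k"
  have "m - (k - 1) = Suc j" using k by (simp add: j_def)
  then have eq: "leg_vec l b m k = leg_vec l b m (k - 1) * resp l b (Suc j)"
    using k by (cases k) (simp_all add: leg_vec_def)
  have "0 < resp l b (Suc j)" using k by (intro pos) (auto simp: j_def)
  \<comment> \<open>As 1 / 0 = 0, a zero denominator would make the next response 0, against its
    positivity.\<close>
  then have "l - resp l b j \<noteq> 0" by auto
  then have "(l - resp l b j) * resp l b (Suc j) = 1" by simp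
  then have "(l - resp l b j) * leg_vec l b m k = leg_vec l b m (k - 1)"
    unfolding eq by (metis mult.left_commute mult.right_neutral)
  then show ?thesis by (simp add: algebra_simps j_def)
qed

lemma leg_vec_inner:
  assumes pos: "\<And>k. k \<in> {1..m} \<Longrightarrow> 0 < resp l b k" and k: "0 < k" "k < m"
  shows "l * leg_vec l b m k = leg_vec l b m (k - 1) + leg_vec l b m (k + 1)"
  using leg_vec_eq[of m l b k] pos k by (simp add: leg_vec_def mult.commute)

lemma leg_vec_last:
  assumes pos: "\<And>k. k \<in> {1..m} \<Longrightarrow> 0 < resp l b k" and m: "0 < m"
  shows "l * leg_vec l b m m = leg_vec l b m (m - 1) + b * leg_vec l b m m"
  using leg_vec_eq[of m l b m] pos m by simp

text \<open>1/t is a fixed point of x -> 1 / (l - x) because l - 1/t = t, and the map is increasing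
  for x < l.\<close>

lemma resp_less_fixpoint:
  assumes "0 < t" "l = t + 1 / t" "b < 1 / t"
  shows "resp l b k < 1 / t"
proof (induction k)
  case (Suc k)
  then have "t < l - resp l b k" using assms by simp
  then show ?case using assms by (simp add: frac_less2)
qed (use assms in auto)

text \<open>The same monotonicity from above; positivity of the responses guarantees that no iterate
  passes the pole at \<open>l\<close>.\<close>

lemma resp_greater_fixpoint:
  assumes "0 < t" "l = t + 1 / t" "1 / t < b" and pos: "\<And>j. j \<in> {1..k} \<Longrightarrow> 0 < resp l b j"
  shows "1 / t < resp l b k"
  using pos
proof (induction k)
  case (Suc k)
  then have "l - resp l b k < t" using assms by simp
  moreover have "0 < l - resp l b k" using Suc.prems[of "Suc k"] by (simp add: zero_less_divide_iff)
  ultimately show ?case using assms by (simp add: frac_less2)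
qed (use assms in auto)

lemma resp_Suc_le:
  assumes "resp l b k \<le> x" "x < l"
  shows "resp l b (Suc k) \<le> 1 / (l - x)"
  using assms by (simp add: frac_le)

text \<open>The iteration is increasing below \<open>l\<close> and maps \<open>x\<close> to at most
  \<open>x\<close>, so an iterate that is at most \<open>x\<close> stays there.\<close>

lemma resp_le_invariant:
  assumes "resp l b k \<le> x" "x < l" "1 / (l - x) \<le> x" "k \<le> m"
  shows "resp l b m \<le> x"
  using assms(4)
proof (induction m rule: dec_induct)
  case (step m)
  then show ?case using resp_Suc_le[of l b m x] assms by linarith
qed (use assms in auto)

text \<open>Shortening a leg with response X gives l - 1/X, and lengthening one with response Y
  gives 1/(l - Y). With l = A + B + C, the change of the sum under alpha or beta is thus a
  difference of two values of x + 1/x.\<close>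

lemma sum_inverse_less:
  fixes x y :: real
  assumes "0 < x" "x < y" "x * y < 1"
  shows "y + 1 / y < x + 1 / x"
proof -
  have "(y - x) * (1 - x * y) > 0" using assms by simp
  then show ?thesis using assms by (simp add: field_simps)
qed

text \<open>The legs h and q1 start on opposite sides of the fixed point 1/t: one at 0, the other at
  \<open>b\<close>, which represents at least two pendant paths.\<close>

lemma alpha_resp_inequality:
  fixes l b C :: real
  assumes l: "2 \<le> l" and b: "2 * l / (l\<^sup>2 - 1) \<le> b"
    and pos: "\<And>k. k \<in> {1..Suc h} \<Longrightarrow> 0 < resp l 0 k" "\<And>k. k \<in> {1..q} \<Longrightarrow> 0 < resp l b k" "0 < C"
    and eq: "l = resp l 0 (Suc h) + resp l b q + C"
  shows "resp l 0 h + resp l b (Suc q) + C < l" "0 < resp l b (Suc q)"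
proof -
  define A where "A = resp l 0 (Suc h)"
  define B where "B = resp l b q"
  \<comment> \<open>The larger root of t^2 - l*t + 1 = 0; the fixed points of the iteration are t
    and 1/t, and 1/t is the smaller one.\<close>
  define t where "t = (l + sqrt (l\<^sup>2 - 4)) / 2"
  have "4 \<le> l\<^sup>2" using l power_mono[of 2 l 2] by simp
  then have "(sqrt (l\<^sup>2 - 4))\<^sup>2 = l\<^sup>2 - 4" by simp
  then have "t * t + 1 = l * t"
    by (simp add: t_def field_simps power2_eq_square)
  moreover have t: "1 \<le> t" using l \<open>4 \<le> l\<^sup>2\<close> by (simp add: t_def) (smt (verit) real_sqrt_ge_zero)
  ultimately have lt: "l = t + 1 / t" by (simp add: field_simps)
  \<comment> \<open>Equivalent to 1/t < 2 * l / (l^2 - 1), the contribution of two pendant paths; t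
    >= l/2 suffices.\<close>
  have "l\<^sup>2 - 1 < 2 * l * t"
  proof -
    have "t \<ge> l / 2" using \<open>4 \<le> l\<^sup>2\<close> by (simp add: t_def)
    then have "2 * l * (l / 2) \<le> 2 * l * t" using l by (intro mult_left_mono) auto
    then show ?thesis by (simp add: power2_eq_square)
  qed
  then have "1 / t < 2 * l / (l\<^sup>2 - 1)" using t \<open>4 \<le> l\<^sup>2\<close> by (simp add: field_simps)
  then have tb: "1 / t < b" using b by simp
  have A: "0 < A" "A < 1 / t"
    unfolding A_def using pos(1) t lt by (auto intro!: resp_less_fixpoint simp del: resp.simps)
  have B: "1 / t < B"
    unfolding B_def using t by (intro resp_greater_fixpoint lt tb pos) auto
  \<comment> \<open>The bound B > 1/t leaves less than l - 1/t = t for the other two legs.\<close>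
  have "A + C < t" using eq B lt by (simp add: A_def B_def)
  then have "A * (A + C) < 1 / t * t"
    using A pos(3) t by (intro mult_strict_mono) auto
  then have *: "A * (A + C) < 1" using t by simp
  have "l - resp l 0 h \<noteq> 0" using A by (auto simp: A_def)
  then have h: "resp l 0 h = l - 1 / A" by (simp add: A_def)
  have q: "resp l b (Suc q) = 1 / (A + C)" using eq by (simp add: A_def B_def)
  show "0 < resp l b (Suc q)" unfolding q using A pos(3) by simp
  show "resp l 0 h + resp l b (Suc q) + C < l"
    unfolding h q using sum_inverse_less[OF A(1) _ *] pos(3) by simp
qed

text \<open>Here \<open>b\<close> and \<open>c\<close> stand for r1 * s and r2 * s, with r1 + 1 <=
  r2 and 3 <= r2. These force l^2 > 5, and then A and B are small enough for B * (B + A) <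
  1.\<close>

lemma beta_resp_inequality:
  fixes l s b c :: real
  assumes l: "0 < l" "1 < l\<^sup>2" and s: "s = l / (l\<^sup>2 - 1)"
    and b: "b + s \<le> c" and c: "3 * s \<le> c"
    and pos: "\<And>k. k \<in> {1..h} \<Longrightarrow> 0 < resp l 0 k" "\<And>k. k \<in> {1..Suc q} \<Longrightarrow> 0 < resp l b k"
      "\<And>k. k \<in> {1..p} \<Longrightarrow> 0 < resp l c k"
    and sizes: "1 \<le> h" "2 \<le> q" "2 \<le> p"
    and eq: "l = resp l 0 h + resp l b (Suc q) + resp l c p"
  shows "resp l 0 h + resp l b q + resp l c (Suc p) < l" "0 < resp l c (Suc p)"
proof -
  define A where "A = resp l 0 h"
  define B where "B = resp l b (Suc q)"
  have s0: "0 < s" using l s by simp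
  have A0: "0 < A" and B0: "0 < B" 
    unfolding A_def B_def using pos(1)[of h] pos(2)[of "Suc q"] sizes by (auto simp del: resp.simps)
  \<comment> \<open>Before the end of the leg, the next response is positive and so has a positive
    denominator; at its end, \<open>l\<close> exceeds \<open>resp l c p\<close> by the positive A +
    B.\<close>
  have less: "resp l c k < l" if "k \<in> {1..p}" for k
  proof (cases "k = p")
    case True
    then show ?thesis using eq A0 B0 by (simp add: A_def B_def del: resp.simps)
  next
    case False
    then have "0 < resp l c (Suc k)" using that by (intro pos) auto
    then show ?thesis by (simp add: zero_less_divide_iff)
  qed
  \<comment> \<open>the two vertices next to \<open>v\<^sub>2\<close> on the leg act at least like one more pendant path of length 2\<close>
  have lc: "c + s < l"
  proof -
    have r1: "0 < resp l c 1" "0 < resp l c 2" using pos(3)[of 1] pos(3)[of 2] sizes by auto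
    define r where "r = resp l c 1"
    have r: "0 < r" "r = 1 / (l - c)" "r < l" using r1 less[of 1] sizes by (auto simp: r_def)
    have "resp l c 2 = 1 / (l - r)" by (simp add: numeral_2_eq_2 r_def)
    then have "1 / (l - r) < l" using less[of 2] sizes by simp
    then have "1 < l * (l - r)" using r(3) by (simp add: pos_divide_less_eq mult.commute)
    then have "r < l - 1 / l" using l by (simp add: field_simps)
    also have "l - 1 / l = 1 / s" using l by (simp add: s field_simps power2_eq_square)
    finally have "r * s < 1" using s0 by (simp add: field_simps)
    moreover have "0 < l - c" using r(1,2) by (simp add: zero_less_divide_iff)
    ultimately show ?thesis unfolding r(2) using s0 by (simp add: field_simps)
  qed
  have "4 * l / (l\<^sup>2 - 1) < l" using lc c by (simp add: s)
  then have l5: "5 < l\<^sup>2" using l by (simp add: field_simps) 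
  \<comment> \<open>2.236 is just below the square root of 5.\<close>
  have "(2236 / 1000)\<^sup>2 < l\<^sup>2" by (rule le_less_trans[OF _ l5]) (simp add: power2_eq_square)
  then have l2: "2236 / 1000 < l" using l power_less_imp_less_base[of "2236/1000" 2 l] by simp
  \<comment> \<open>For l^2 = 5 the smaller fixed point is about 0.618; 0.625 lies slightly above it
    and traps the iteration started at 0.\<close>
  have A: "A \<le> 625 / 1000"
    unfolding A_def
  proof (rule resp_le_invariant[where k = 0])
    show "1 / (l - 625 / 1000) \<le> 625 / 1000" using l2 by (simp add: field_simps)
  qed (use l2 in auto)
  \<comment> \<open>Since b + s <= c and c + s < l, the start is at most l - 2 * s. Three explicit
    iterations bring the response below 3 / (2 * l) <= 0.671, which is again a trap; q >= 2 ensures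
    that the leg has at least three edges.\<close>
  have "resp l b 0 \<le> l - 2 * s" using b lc by simp
  then have "resp l b 1 \<le> 1 / (2 * s)"
    using resp_Suc_le[of l b 0 "l - 2 * s"] s0 by simp
  also have "1 / (2 * s) = l - (l\<^sup>2 + 1) / (2 * l)"
    using l by (simp add: s field_simps power2_eq_square)
  finally have "resp l b 2 \<le> 1 / ((l\<^sup>2 + 1) / (2 * l))"
    using resp_Suc_le[of l b 1 "l - (l\<^sup>2 + 1) / (2 * l)"] l
    by (simp add: numeral_2_eq_2 add_pos_pos)
  also have "\<dots> = 2 * l / (l\<^sup>2 + 1)" by simp
  also have "\<dots> \<le> l / 3" using l l5 by (simp add: field_simps)
  finally have "resp l b 3 \<le> 1 / (l - l / 3)"
    using resp_Suc_le[of l b 2 "l / 3"] l by (simp add: numeral_3_eq_3 numeral_2_eq_2)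
  also have "\<dots> \<le> 671 / 1000" using l2 by (simp add: field_simps)
  finally have B: "B \<le> 671 / 1000"
    unfolding B_def
  proof (rule resp_le_invariant)
    show "1 / (l - 671 / 1000) \<le> 671 / 1000" using l2 by (simp add: field_simps)
  qed (use l2 sizes in auto)
  have "B * (B + A) \<le> 671 / 1000 * (671 / 1000 + 625 / 1000)"
    using A B A0 B0 by (intro mult_mono) auto
  then have *: "B * (B + A) < 1" by simp
  have "l - resp l b q \<noteq> 0" using B0 by (auto simp: B_def)
  then have q: "resp l b q = l - 1 / B" by (simp add: B_def)
  have p: "resp l c (Suc p) = 1 / (B + A)" using eq by (simp add: A_def B_def)
  show "0 < resp l c (Suc p)" unfolding p using A0 B0 by simp
  show "resp l 0 h + resp l b q + resp l c (Suc p) < l"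
    unfolding q p using sum_inverse_less[OF B0 _ *] A0 by (simp add: A_def)
qed

section \<open>The eigenvalue equation at each kind of vertex of [h,q1,q2]\<close>

section \<open>Neighbour sums in the trees\<close>

text \<open>A leg with offset \<open>d\<close> has own vertices d+1, d+2, ...; its attached end is
  always the root 0, so position 0 must be treated apart.\<close>

definition leg_pos :: "nat \<Rightarrow> nat \<Rightarrow> nat" where
  "leg_pos d k = (if k = 0 then 0 else d + k)"

lemma leg_pos_simps [simp]: "leg_pos d 0 = 0" "0 < k \<Longrightarrow> leg_pos d k = d + k"
  by (simp_all add: leg_pos_def)

context
  fixes r1 r2 h q1 q2 :: nat and v :: "nat \<Rightarrow> real"
  assumes sizes: "1 \<le> h" "1 \<le> q1" "1 \<le> q2"
begin

private abbreviation "S \<equiv>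
  nbr_sum (1 + h + q1 + q2 + 2 * (r1 + r2)) (tree_par r1 h q1 q2) v"
private abbreviation "children x \<equiv>
  {y. 0 < y \<and> y < 1 + h + q1 + q2 + 2 * (r1 + r2) \<and> tree_par r1 h q1 q2 y = x}"

lemma pendant_cases:
  assumes "h + q1 + q2 < y"
  obtains i where "y = h + q1 + q2 + 1 + 2 * i" | i where "y = h + q1 + q2 + 2 + 2 * i"
proof -
  define i where "i = (y - (h + q1 + q2) - 1) div 2"
  have "y = h + q1 + q2 + 1 + 2 * i \<or> y = h + q1 + q2 + 2 + 2 * i"
    using assms by (auto simp: i_def)
  then show thesis using that by blast
qed

lemma tree_par_mid:
  "tree_par r1 h q1 q2 (h + q1 + q2 + 1 + 2 * i) = (if i < r1 then h + q1 else h + q1 + q2)"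
  using sizes by (auto simp: tree_par_high)

lemma tree_par_end:
  "tree_par r1 h q1 q2 (h + q1 + q2 + 2 + 2 * i) = h + q1 + q2 + 1 + 2 * i"
  using sizes by (auto simp: tree_par_high)

lemma nbr_sum_root: "S 0 = v 1 + v (h + 1) + v (h + q1 + 1)"
proof -
  have "children 0 = {1, h + 1, h + q1 + 1}"
    using sizes by (auto simp: tree_par_def split: if_splits)
  then show ?thesis using sizes by (simp add: nbr_sum_def)
qed

text \<open>The pairs (d, m) list offset and length of the three legs, so one statement covers the
  interior vertices of all of them.\<close>

lemma nbr_sum_leg:
  assumes "(d, m) \<in> {(0, h), (h, q1), (h + q1, q2)}" "0 < k" "k < m"
  shows "S (leg_pos d k) = v (leg_pos d (k - 1)) + v (leg_pos d (k + 1))"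
proof -
  have le: "d + m \<le> h + q1 + q2" using assms(1) by auto
  have "tree_par r1 h q1 q2 y = d + k \<longleftrightarrow> y = d + k + 1"
    if "0 < y" for y
  proof (cases "y \<le> h + q1 + q2")
    case True
    then show ?thesis using assms that by (auto simp: tree_par_low)
  next
    case False
    then show ?thesis using assms le sizes by (auto simp: tree_par_high)
  qed
  then have "children (d + k) = {d + k + 1}"
    using le assms(3) by auto
  moreover have "tree_par r1 h q1 q2 (d + k) = leg_pos d (k - 1)"
    using assms le by (auto simp: tree_par_low leg_pos_def)
  ultimately show ?thesis using assms(2) by (simp add: nbr_sum_def)
qed

lemma nbr_sum_leaf: "S (leg_pos 0 h) = v (leg_pos 0 (h - 1))"
proof -
  have "tree_par r1 h q1 q2 y \<noteq> h" if "0 < y" for y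
    using sizes that by (cases "y \<le> h + q1 + q2") (auto simp: tree_par_low tree_par_high)
  then have "children h = {}" by auto
  then have "sum v (children h) = 0" by (simp only: sum.empty)
  moreover have "tree_par r1 h q1 q2 h = leg_pos 0 (h - 1)"
    using sizes by (auto simp: tree_par_low leg_pos_def)
  ultimately show ?thesis using sizes by (simp add: nbr_sum_def)
qed

lemma nbr_sum_hub1:
  "S (leg_pos h q1) = v (leg_pos h (q1 - 1)) + (\<Sum>i<r1. v (h + q1 + q2 + 1 + 2 * i))"
proof -
  have "children (h + q1) = (\<lambda>i. h + q1 + q2 + 1 + 2 * i) ` {..<r1}" (is "_ = ?R")
  proof (rule subset_antisym; rule subsetI)
    fix y assume y: "y \<in> children (h + q1)"
    show "y \<in> ?R"
    proof (cases "y \<le> h + q1 + q2")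
      case True
      then show ?thesis using y sizes by (auto simp: tree_par_low split: if_splits)
    next
      case False
      then have "h + q1 + q2 < y" by simp
      then show ?thesis
      proof (cases rule: pendant_cases)
        case (1 i)
        then have "i < r1"
          using y sizes tree_par_mid[of i] by (auto split: if_splits)
        then show ?thesis using 1 by blast
      next
        case (2 i)
        then show ?thesis using y sizes tree_par_end[of i] by simp
      qed
    qed
  next
    fix y assume "y \<in> ?R"
    then obtain i where "i < r1" "y = h + q1 + q2 + 1 + 2 * i" by blast
    then show "y \<in> children (h + q1)" using tree_par_mid[of i] by simp
  qed
  moreover have "tree_par r1 h q1 q2 (h + q1) = leg_pos h (q1 - 1)"
    using sizes by (auto simp: tree_par_low leg_pos_def)
  ultimately show ?thesis using sizes
    by (simp add: nbr_sum_def sum.reindex inj_on_def)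
qed

lemma nbr_sum_hub2:
  "S (leg_pos (h + q1) q2) =
    v (leg_pos (h + q1) (q2 - 1)) + (\<Sum>i<r2. v (h + q1 + q2 + 1 + 2 * (r1 + i)))"
proof -
  have "children (h + q1 + q2) = (\<lambda>i. h + q1 + q2 + 1 + 2 * (r1 + i)) ` {..<r2}" (is "_ = ?R")
  proof (rule subset_antisym; rule subsetI)
    fix y assume y: "y \<in> children (h + q1 + q2)"
    show "y \<in> ?R"
    proof (cases "y \<le> h + q1 + q2")
      case True
      then show ?thesis using y sizes by (auto simp: tree_par_low split: if_splits)
    next
      case False
      then have "h + q1 + q2 < y" by simp
      then show ?thesis
      proof (cases rule: pendant_cases)
        case (1 i)
        then have "r1 \<le> i"
          using y sizes tree_par_mid[of i] by (auto split: if_splits)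
        \<comment> \<open>Pendant paths are numbered consecutively over both hubs, so those of v2
          are reindexed by subtracting \<open>r1\<close>.\<close>
        then have "y = h + q1 + q2 + 1 + 2 * (r1 + (i - r1))" "i - r1 < r2"
          using y 1 by auto
        then show ?thesis by blast
      next
        case (2 i)
        then show ?thesis using y tree_par_end[of i] by simp
      qed
    qed
  next
    fix y assume "y \<in> ?R"
    then obtain i where "i < r2" "y = h + q1 + q2 + 1 + 2 * (r1 + i)" by blast
    then show "y \<in> children (h + q1 + q2)" using tree_par_mid[of "r1 + i"] by simp
  qed
  moreover have "tree_par r1 h q1 q2 (h + q1 + q2) = leg_pos (h + q1) (q2 - 1)"
    using sizes by (auto simp: tree_par_low leg_pos_def)
  ultimately show ?thesis using sizes
    by (simp add: nbr_sum_def sum.reindex inj_on_def)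
qed

lemma nbr_sum_pendant_mid:
  assumes "i < r1 + r2"
  shows "S (h + q1 + q2 + 1 + 2 * i) =
    v (if i < r1 then h + q1 else h + q1 + q2) + v (h + q1 + q2 + 2 + 2 * i)"
proof -
  have iff: "tree_par r1 h q1 q2 y = h + q1 + q2 + 1 + 2 * i \<longleftrightarrow> y = h + q1 + q2 + 2 + 2 * i"
    if "0 < y" for y
  proof (cases "y \<le> h + q1 + q2")
    case True
    then show ?thesis using that sizes by (auto simp: tree_par_low)
  next
    case False
    then have "h + q1 + q2 < y" by simp
    then show ?thesis
    proof (cases rule: pendant_cases)
      case (1 j)
      then have "y \<noteq> h + q1 + q2 + 2 + 2 * i" by presburger
      then show ?thesis using 1 tree_par_mid[of j] by simp
    next
      case (2 j)
      then show ?thesis using tree_par_end[of j] by simp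
    qed
  qed
  then have "children (h + q1 + q2 + 1 + 2 * i) =
      {y. 0 < y \<and> y < 1 + h + q1 + q2 + 2 * (r1 + r2) \<and> y = h + q1 + q2 + 2 + 2 * i}"
    by (intro Collect_cong conj_cong refl iff)
  also have "\<dots> = {h + q1 + q2 + 2 + 2 * i}"
    using assms by auto
  finally show ?thesis using tree_par_mid[of i] by (simp add: nbr_sum_def)
qed

lemma nbr_sum_pendant_end: "S (h + q1 + q2 + 2 + 2 * i) = v (h + q1 + q2 + 1 + 2 * i)"
proof -
  have "tree_par r1 h q1 q2 y \<noteq> h + q1 + q2 + 2 + 2 * i" if "0 < y" for y
  proof (cases "y \<le> h + q1 + q2")
    case True
    then show ?thesis using that sizes by (auto simp: tree_par_low)
  next
    case False
    then have "h + q1 + q2 < y" by simp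
    then show ?thesis
    proof (cases rule: pendant_cases)
      case (1 j)
      then show ?thesis using tree_par_mid[of j] by simp
    next
      case (2 j)
      then show ?thesis using tree_par_end[of j] by simp presburger
    qed
  qed
  then have "children (h + q1 + q2 + 2 + 2 * i) = {}" by blast
  then have "sum v (children (h + q1 + q2 + 2 + 2 * i)) = 0" by (simp only: sum.empty)
  then show ?thesis using tree_par_end[of i] by (simp add: nbr_sum_def)
qed

text \<open>The cases match the neighbour-sum lemmas above one by one, so an inequality at all
  vertices can be checked by kind of vertex.\<close>

lemma tree_vertex_cases:
  assumes "x < 1 + h + q1 + q2 + 2 * (r1 + r2)"
  obtains "x = 0"
  | d m k where "(d, m) \<in> {(0, h), (h, q1), (h + q1, q2)}" "0 < k" "k < m" "x = leg_pos d k"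
  | "x = leg_pos 0 h" | "x = leg_pos h q1" | "x = leg_pos (h + q1) q2"
  | i where "i < r1 + r2" "x = h + q1 + q2 + 1 + 2 * i"
  | i where "i < r1 + r2" "x = h + q1 + q2 + 2 + 2 * i"
proof -
  consider "x = 0" | "0 < x" "x < h" | "x = h" | "h < x" "x < h + q1" | "x = h + q1" |
    "h + q1 < x" "x < h + q1 + q2" | "x = h + q1 + q2" | "h + q1 + q2 < x" by linarith
  then show thesis
  proof cases
    case 1
    then show ?thesis by (rule that(1))
  next
    case 2
    then show ?thesis by (intro that(2)[of 0 h x]) simp_all
  next
    case 3
    then show ?thesis using sizes by (intro that(3)) simp
  next
    case 4
    then show ?thesis by (intro that(2)[of h q1 "x - h"]) simp_all
  next
    case 5
    then show ?thesis using sizes by (intro that(4)) simp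
  next
    case 6
    then show ?thesis by (intro that(2)[of "h + q1" q2 "x - (h + q1)"]) (simp_all add: less_diff_conv2)
  next
    case 7
    then show ?thesis using sizes by (intro that(5)) simp
  next
    case 8
    define i where "i = (x - (h + q1 + q2) - 1) div 2"
    have i: "i < r1 + r2" "x = h + q1 + q2 + 1 + 2 * i \<or> x = h + q1 + q2 + 2 + 2 * i"
      using 8 assms by (auto simp: i_def)
    from i(2) show ?thesis
    proof
      assume "x = h + q1 + q2 + 1 + 2 * i"
      then show ?thesis by (rule that(6)[OF i(1)])
    next
      assume "x = h + q1 + q2 + 2 + 2 * i"
      then show ?thesis by (rule that(7)[OF i(1)])
    qed
  qed
qed

end

section \<open>Transfer between spectral radii and leg responses, and part (b)\<close>

section \<open>Comparison of spectral radii\<close>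

text \<open>All facts are read off a positive Perron vector: a pendant path gives the sign
  conditions on \<open>l\<close>, the legs give positive responses, and the equation at the root,
  divided by its entry, gives the final identity.\<close>

lemma tree_rho_resp:
  fixes r1 r2 h q1 q2 :: nat and l s :: real
  assumes sizes: "1 \<le> h" "1 \<le> q1" "1 \<le> q2" and r: "0 < r1 + r2"
  defines "l \<equiv> rho (tree r1 r2 (h, q1, q2))"
  defines "s \<equiv> l / (l\<^sup>2 - 1)"
  shows "0 < l" "1 < l\<^sup>2"
    "\<And>k. k \<in> {1..h} \<Longrightarrow> 0 < resp l 0 k"
    "\<And>k. k \<in> {1..q1} \<Longrightarrow> 0 < resp l (r1 * s) k"
    "\<And>k. k \<in> {1..q2} \<Longrightarrow> 0 < resp l (r2 * s) k"
    "l = resp l 0 h + resp l (r1 * s) q1 + resp l (r2 * s) q2"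
proof -
  let ?N = "1 + h + q1 + q2 + 2 * (r1 + r2)"
  let ?p = "tree_par r1 h q1 q2"
  obtain v where vpos: "\<And>x. x < ?N \<Longrightarrow> 0 < v x"
    and "\<And>x. x < ?N \<Longrightarrow> rho (pgraph ?N ?p) * v x = nbr_sum ?N ?p v x"
    by (rule pgraph_perron[of ?N ?p]) (use sizes in \<open>auto simp: tree_par_less\<close>)
  then have eq: "l * v x = nbr_sum ?N ?p v x" if "x < ?N" for x
    using that sizes by (simp add: l_def tree_eq_pgraph)
  define mid where "mid i = v (h + q1 + q2 + 1 + 2 * i)" for i
  define hub where "hub i = v (if i < r1 then h + q1 else h + q1 + q2)" for i
  \<comment> \<open>With leaf entry e, the two equations of a pendant path give mid = l * e and hub
    = (l^2 - 1) * e; all entries being positive, this yields both signs and the ratio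
    \<open>s\<close>.\<close>
  have pendant: "0 < l \<and> 1 < l\<^sup>2 \<and> mid i = s * hub i" if i: "i < r1 + r2" for i
  proof -
    define e where "e = v (h + q1 + q2 + 2 + 2 * i)"
    have pos: "0 < e" "0 < mid i" "0 < hub i"
      unfolding e_def mid_def hub_def using i by (auto intro!: vpos)
    have 1: "l * e = mid i"
      using eq[of "h + q1 + q2 + 2 + 2 * i"] nbr_sum_pendant_end[OF sizes, of r1 r2 v i] i
      by (simp add: e_def mid_def)
    have 2: "l * mid i = hub i + e"
      using eq[of "h + q1 + q2 + 1 + 2 * i"] nbr_sum_pendant_mid[OF sizes i, of v] i
      by (simp add: e_def mid_def hub_def)
    have "0 < l" using 1 pos by (metis zero_less_mult_pos2)
    have 3: "(l\<^sup>2 - 1) * e = hub i"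
      using 2 unfolding 1[symmetric] by (simp add: power2_eq_square algebra_simps)
    then have "0 < l\<^sup>2 - 1" using pos by (metis zero_less_mult_pos2)
    moreover from this have "mid i = s * hub i"
      unfolding 3[symmetric] 1[symmetric] s_def by simp
    ultimately show ?thesis using \<open>0 < l\<close> by simp
  qed
  show "0 < l" "1 < l\<^sup>2" using pendant[OF r] by auto
  have mid1: "(\<Sum>i<r1. mid i) = r1 * s * v (leg_pos h q1)"
    using pendant sizes by (simp add: hub_def)
  have mid2: "(\<Sum>i<r2. mid (r1 + i)) = r2 * s * v (leg_pos (h + q1) q2)"
    using pendant sizes by (simp add: hub_def)
  have pos: "0 < v (leg_pos d k)" if "(d, m) \<in> {(0, h), (h, q1), (h + q1, q2)}" "k \<le> m" for d m k
    using that by (intro vpos) (auto simp: leg_pos_def)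
  have inner: "l * v (leg_pos d k) = v (leg_pos d (k - 1)) + v (leg_pos d (k + 1))"
    if "(d, m) \<in> {(0, h), (h, q1), (h + q1, q2)}" "0 < k" "k < m" for d m k
    using eq[of "leg_pos d k"] nbr_sum_leg[OF sizes that, of r1 r2 v] that
    by (auto simp: leg_pos_def)
  have last0: "l * v (leg_pos 0 h) = v (leg_pos 0 (h - 1)) + 0 * v (leg_pos 0 h)"
    using eq[of "leg_pos 0 h"] nbr_sum_leaf[OF sizes, of r1 r2 v] sizes
    by simp
  have last1: "l * v (leg_pos h q1) = v (leg_pos h (q1 - 1)) + r1 * s * v (leg_pos h q1)"
    using eq[of "leg_pos h q1"] nbr_sum_hub1[OF sizes, of r1 r2 v] sizes
    unfolding mid1[symmetric] mid_def by simp
  have last2: "l * v (leg_pos (h + q1) q2) =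
      v (leg_pos (h + q1) (q2 - 1)) + r2 * s * v (leg_pos (h + q1) q2)"
    using eq[of "leg_pos (h + q1) q2"] nbr_sum_hub2[OF sizes, of r1 r2 v] sizes
    unfolding mid2[symmetric] mid_def by simp
  have leg: "(\<forall>k\<in>{1..m}. 0 < resp l b k) \<and> v (leg_pos d 1) = resp l b m * v 0"
    if "(d, m) \<in> {(0, h), (h, q1), (h + q1, q2)}"
      "l * v (leg_pos d m) = v (leg_pos d (m - 1)) + b * v (leg_pos d m)" for d m b
  proof -
    have "1 \<le> m" using that sizes by auto
    note * = pos[OF that(1)] inner[OF that(1)] that(2)
    have "v (leg_pos d (m - (m - 1))) = resp l b (Suc (m - 1)) * v (leg_pos d (m - Suc (m - 1)))"
      by (rule resp_of_leg[where f = "\<lambda>k. v (leg_pos d k)"]) (use * \<open>1 \<le> m\<close> in auto)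
    moreover have "0 < resp l b k" if "k \<in> {1..m}" for k
      by (rule resp_pos_of_leg[where f = "\<lambda>k. v (leg_pos d k)" and m = m]) (use * that in auto)
    ultimately show ?thesis using \<open>1 \<le> m\<close> by (simp del: resp.simps)
  qed
  note l0 = leg[OF _ last0] and l1 = leg[OF _ last1] and l2 = leg[OF _ last2]
  show "0 < resp l 0 k" if "k \<in> {1..h}" for k using l0 that by simp
  show "0 < resp l (r1 * s) k" if "k \<in> {1..q1}" for k using l1 that by simp
  show "0 < resp l (r2 * s) k" if "k \<in> {1..q2}" for k using l2 that by simp
  have "l * v 0 = v (leg_pos 0 1) + v (leg_pos h 1) + v (leg_pos (h + q1) 1)"
    using eq[of 0] nbr_sum_root[OF sizes, of r1 r2 v] by simp
  also have "\<dots> = (resp l 0 h + resp l (r1 * s) q1 + resp l (r2 * s) q2) * v 0"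
    using l0 l1 l2 by (simp add: algebra_simps)
  finally show "l = resp l 0 h + resp l (r1 * s) q1 + resp l (r2 * s) q2"
    using vpos[of 0] by simp
qed

text \<open>Gluing the leg vectors at a root entry 1 and extending to the pendant paths gives a
  positive vector that satisfies the equation for \<open>l\<close> exactly at every vertex except
  the root, where \<open>less\<close> makes it strictly superharmonic.\<close>

lemma rho_tree_less:
  fixes r1 r2 h q1 q2 :: nat and l s :: real
  assumes sizes: "1 \<le> h" "1 \<le> q1" "1 \<le> q2" and l: "0 < l" "1 < l\<^sup>2"
    and s: "s = l / (l\<^sup>2 - 1)"
    and pos0: "\<And>k. k \<in> {1..h} \<Longrightarrow> 0 < resp l 0 k"
    and pos1: "\<And>k. k \<in> {1..q1} \<Longrightarrow> 0 < resp l (r1 * s) k"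
    and pos2: "\<And>k. k \<in> {1..q2} \<Longrightarrow> 0 < resp l (r2 * s) k"
    and less: "resp l 0 h + resp l (r1 * s) q1 + resp l (r2 * s) q2 < l"
  shows "rho (tree r1 r2 (h, q1, q2)) < l"
proof -
  define n where "n = h + q1 + q2"
  define hub where "hub i = (if i < r1 then leg_vec l (r1 * s) q1 q1 else leg_vec l (r2 * s) q2 q2)"
    for i
  \<comment> \<open>Pendant path i has offsets 2i+1 and 2i+2 from \<open>n\<close>; halving gives i
    and i+1, hence the correction by 1 at the leaf.\<close>
  define v where "v x =
     (if x \<le> h then leg_vec l 0 h x
      else if x \<le> h + q1 then leg_vec l (r1 * s) q1 (x - h)
      else if x \<le> n then leg_vec l (r2 * s) q2 (x - (h + q1))
      else if odd (x - n) then s * hub ((x - n) div 2)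
      else hub ((x - n) div 2 - 1) / (l\<^sup>2 - 1))" for x
  let ?N = "1 + h + q1 + q2 + 2 * (r1 + r2)"
  let ?p = "tree_par r1 h q1 q2"
  have s0: "0 < s" using l s by simp
  have leg0: "v (leg_pos 0 k) = leg_vec l 0 h k" if "k \<le> h" for k
    using that by (auto simp: v_def leg_pos_def)
  have leg1: "v (leg_pos h k) = leg_vec l (r1 * s) q1 k" if "k \<le> q1" for k
    using that by (auto simp: v_def leg_pos_def)
  have leg2: "v (leg_pos (h + q1) k) = leg_vec l (r2 * s) q2 k" if "k \<le> q2" for k
    using that by (auto simp: v_def leg_pos_def n_def)
  have hub1: "v (h + q1) = leg_vec l (r1 * s) q1 q1" using leg1[of q1] sizes by simp
  have hub2: "v (h + q1 + q2) = leg_vec l (r2 * s) q2 q2" using leg2[of q2] sizes by simp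
  have mid: "v (h + q1 + q2 + 1 + 2 * i) = s * hub i" for i
    by (simp add: v_def n_def)
  have end': "v (h + q1 + q2 + 2 + 2 * i) = hub i / (l\<^sup>2 - 1)" for i
    by (simp add: v_def n_def)
  have hub: "hub i = v (if i < r1 then h + q1 else h + q1 + q2)" for i
    by (simp add: hub_def hub1 hub2)
  have hubpos: "0 < hub i" for i
    unfolding hub_def using leg_vec_pos[of q1 l "r1 * s" q1] leg_vec_pos[of q2 l "r2 * s" q2] pos1 pos2
    by simp
  have leg: "0 < v (leg_pos d k) \<and>
      (0 < k \<and> k < m \<longrightarrow> l * v (leg_pos d k) = v (leg_pos d (k - 1)) + v (leg_pos d (k + 1)))"
    if "(d, m) \<in> {(0, h), (h, q1), (h + q1, q2)}" "k \<le> m" for d m k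
  proof -
    from that(1) consider "d = 0" "m = h" | "d = h" "m = q1" | "d = h + q1" "m = q2" by auto
    then show ?thesis
    proof cases
      case 1
      then show ?thesis
        using that(2) leg0[of k] leg0[of "k - 1"] leg0[of "k + 1"] pos0
          leg_vec_pos[of h l 0 k] leg_vec_inner[of h l 0 k]
        by (cases "k = 0") simp_all
    next
      case 2
      then show ?thesis
        using that(2) leg1[of k] leg1[of "k - 1"] leg1[of "k + 1"] pos1
          leg_vec_pos[of q1 l "r1 * s" k] leg_vec_inner[of q1 l "r1 * s" k]
        by (cases "k = 0") simp_all
    next
      case 3
      then show ?thesis
        using that(2) leg2[of k] leg2[of "k - 1"] leg2[of "k + 1"] pos2
          leg_vec_pos[of q2 l "r2 * s" k] leg_vec_inner[of q2 l "r2 * s" k]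
        by (cases "k = 0") simp_all
    qed
  qed
  have root: "v 0 = 1" by (simp add: v_def)
  have "nbr_sum ?N ?p v 0 = resp l 0 h + resp l (r1 * s) q1 + resp l (r2 * s) q2"
    using nbr_sum_root[OF sizes, of r1 r2 v] leg0[of 1] leg1[of 1] leg2[of 1] sizes by simp
  then have root_less: "nbr_sum ?N ?p v 0 < l * v 0" using less root by simp
  have key: "0 < v x \<and> nbr_sum ?N ?p v x \<le> l * v x" if "x < ?N" for x
    using sizes that
  proof (cases rule: tree_vertex_cases)
    case 1
    then show ?thesis using root_less root by simp
  next
    case (2 d m k)
    then show ?thesis
      using leg[of d m k] nbr_sum_leg[OF sizes, of d m k r1 r2 v] by simp
  next
    case 3
    have "l * v (leg_pos 0 h) = v (leg_pos 0 (h - 1))"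
      using leg0[of h] leg0[of "h - 1"] leg_vec_last[of h l 0] pos0 sizes by simp
    then show ?thesis
      using 3 leg[of 0 h h] nbr_sum_leaf[OF sizes, of r1 r2 v] by simp
  next
    case 4
    have "l * v (leg_pos h q1) = v (leg_pos h (q1 - 1)) + r1 * s * v (leg_pos h q1)"
      using leg1[of q1] leg1[of "q1 - 1"] leg_vec_last[of q1 l "r1 * s"] pos1 sizes by simp
    moreover have "(\<Sum>i<r1. v (h + q1 + q2 + 1 + 2 * i)) = r1 * s * v (leg_pos h q1)"
      using leg1[of q1] unfolding mid by (simp add: hub_def)
    ultimately show ?thesis
      using 4 leg[of h q1 q1] nbr_sum_hub1[OF sizes, of r1 r2 v] by simp
  next
    case 5
    have "l * v (leg_pos (h + q1) q2) =
        v (leg_pos (h + q1) (q2 - 1)) + r2 * s * v (leg_pos (h + q1) q2)"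
      using leg2[of q2] leg2[of "q2 - 1"] leg_vec_last[of q2 l "r2 * s"] pos2 sizes by simp
    moreover have "(\<Sum>i<r2. v (h + q1 + q2 + 1 + 2 * (r1 + i))) =
        r2 * s * v (leg_pos (h + q1) q2)"
      using leg2[of q2] unfolding mid by (simp add: hub_def)
    ultimately show ?thesis
      using 5 leg[of "h + q1" q2 q2] nbr_sum_hub2[OF sizes, of r1 r2 v] by simp
  next
    case (6 i)
    have "l * (s * hub i) = hub i + hub i / (l\<^sup>2 - 1)"
      using l by (simp add: s field_simps power2_eq_square)
    then show ?thesis
      using nbr_sum_pendant_mid[OF sizes 6(1), of v] hubpos[of i] s0
      unfolding 6(2) mid end' hub[symmetric] by simp
  next
    case (7 i)
    then show ?thesis
      using nbr_sum_pendant_end[OF sizes, of r1 r2 v i] hubpos[of i] l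
      unfolding 7(2) mid end' by (simp add: s)
  qed
  have "rho (pgraph ?N ?p) < l"
  proof (rule rho_pgraph_less)
    show "nbr_sum ?N ?p v 0 < l * v 0" by (rule root_less)
  qed (use key sizes in \<open>auto simp: tree_par_less\<close>)
  then show ?thesis using sizes by (simp add: tree_eq_pgraph)
qed

text \<open>Positivity of the first response at a hub with at least three pendant paths means 3 * s
  < l, that is l^2 > 4. It makes the fixed point 1/t in the argument for alpha real.\<close>

lemma rho_lower_bound:
  fixes l s :: real and r :: nat
  assumes l: "0 < l" "1 < l\<^sup>2" and s: "s = l / (l\<^sup>2 - 1)" and r: "3 \<le> r"
    and pos: "0 < resp l (r * s) 1"
  shows "2 \<le> l"
proof -
  have "r * s < l" using pos by (simp add: zero_less_divide_iff)
  moreover have "3 * s \<le> r * s" using r l s by (intro mult_right_mono) auto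
  ultimately have "3 * l / (l\<^sup>2 - 1) < l" by (simp add: s)
  then have "2\<^sup>2 < l\<^sup>2" using l by (simp add: field_simps)
  then show ?thesis using l by (meson less_imp_le power_less_imp_less_base)
qed

lemma rho_alpha_less:
  assumes "2 \<le> r1" "r1 < r2" "3 \<le> h" "2 \<le> q1" "2 \<le> q2"
  shows "rho (tree r1 r2 (h - 1, q1 + 1, q2)) < rho (tree r1 r2 (h, q1, q2))"
proof -
  define l where "l = rho (tree r1 r2 (h, q1, q2))"
  define s where "s = l / (l\<^sup>2 - 1)"
  have sizes: "1 \<le> h" "1 \<le> q1" "1 \<le> q2" "0 < r1 + r2" using assms by auto
  note T = tree_rho_resp[OF sizes, folded l_def, folded s_def]
  obtain k where h: "h = Suc k" using assms by (cases h) auto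
  have "2 \<le> l"
    using rho_lower_bound[OF T(1,2) s_def, of r2] T(5)[of 1] assms by simp
  moreover have "2 * l / (l\<^sup>2 - 1) \<le> r1 * s"
    using mult_right_mono[of 2 "real r1" s] T(1,2) assms by (simp add: s_def)
  moreover have "0 < resp l (r2 * s) q2" using T(5) assms by simp
  ultimately have *: "resp l 0 k + resp l (r1 * s) (Suc q1) + resp l (r2 * s) q2 < l"
      "0 < resp l (r1 * s) (Suc q1)"
    using alpha_resp_inequality[of l "r1 * s" k q1 "resp l (r2 * s) q2"] T(3,4,6) unfolding h by blast+
  have "rho (tree r1 r2 (k, Suc q1, q2)) < l"
  proof (rule rho_tree_less[OF _ _ _ T(1,2) s_def])
    \<comment> \<open>Only the response at the added edge is new; the others come from the old tree,
      evaluated at the same \<open>l\<close>.\<close>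
    show "0 < resp l (r1 * s) j" if "j \<in> {1..Suc q1}" for j
      using that T(4)[of j] *(2) by (cases "j = Suc q1") auto
  qed (use T(3,5) * assms h in auto)
  then show ?thesis by (simp add: h l_def)
qed

lemma rho_beta_less:
  assumes "2 \<le> r1" "r1 < r2" "2 \<le> h" "3 \<le> q1" "2 \<le> q2"
  shows "rho (tree r1 r2 (h, q1 - 1, q2 + 1)) < rho (tree r1 r2 (h, q1, q2))"
proof -
  define l where "l = rho (tree r1 r2 (h, q1, q2))"
  define s where "s = l / (l\<^sup>2 - 1)"
  have sizes: "1 \<le> h" "1 \<le> q1" "1 \<le> q2" "0 < r1 + r2" using assms by auto
  note T = tree_rho_resp[OF sizes, folded l_def, folded s_def]
  obtain k where q1: "q1 = Suc k" using assms by (cases q1) auto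
  have s: "0 < s" using T(1,2) by (simp add: s_def)
  have "(real r1 + 1) * s \<le> r2 * s" using assms s by (intro mult_right_mono) auto
  then have "r1 * s + s \<le> r2 * s" by (simp add: algebra_simps)
  moreover have "3 * s \<le> r2 * s" using assms s by (intro mult_right_mono) auto
  ultimately have *: "resp l 0 h + resp l (r1 * s) k + resp l (r2 * s) (Suc q2) < l"
      "0 < resp l (r2 * s) (Suc q2)"
    using beta_resp_inequality[OF T(1,2) s_def, of "r1 * s" "r2 * s" h k q2] T(3-6) assms
    unfolding q1 by auto
  have "rho (tree r1 r2 (h, k, Suc q2)) < l"
  proof (rule rho_tree_less[OF _ _ _ T(1,2) s_def])
    show "0 < resp l (r2 * s) j" if "j \<in> {1..Suc q2}" for j
      using that T(5)[of j] *(2) by (cases "j = Suc q2") auto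
  qed (use T(3,4) * assms q1 in auto)
  then show ?thesis by (simp add: q1 l_def)
qed

text \<open>The intermediate tree [h-1,q1+1,q2] has a q1-leg with at least three edges, so the bound
  for beta applies even when q1 = 2.\<close>

lemma rho_gamma_less:
  assumes "2 \<le> r1" "r1 < r2" "3 \<le> h" "2 \<le> q1" "2 \<le> q2"
  shows "rho (tree r1 r2 (h - 1, q1, q2 + 1)) < rho (tree r1 r2 (h, q1, q2))"
proof -
  have "rho (tree r1 r2 (h - 1, q1 + 1 - 1, q2 + 1)) < rho (tree r1 r2 (h - 1, q1 + 1, q2))"
    using assms by (intro rho_beta_less) auto
  also have "\<dots> < rho (tree r1 r2 (h, q1, q2))"
    using assms by (intro rho_alpha_less) auto
  finally show ?thesis by simp
qed

section \<open>Parts (c) and (d): moving edges from the pendant leg to the other two\<close>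

section \<open>Reachability\<close>

text \<open>Stated for an arbitrary relation \<open>R\<close> so that it serves both step relations;
  k + 2 <= h keeps h >= 3 before each application.\<close>

lemma alpha_reaches:
  assumes "\<And>T. T \<in> dom_alpha r1 r2 n \<Longrightarrow> (T, alpha T) \<in> R"
    and "(h, q1, q2) \<in> Fam r1 r2 n" "k + 2 \<le> h"
  shows "((h, q1, q2), (h - k, q1 + k, q2)) \<in> R\<^sup>*"
  using assms(3)
proof (induction k)
  case (Suc k)
  have "((h - k, q1 + k, q2), alpha (h - k, q1 + k, q2)) \<in> R"
    using Suc.prems assms(2) by (intro assms(1)) (auto simp: dom_alpha_def Fam_def)
  with Suc show ?case by (auto intro: rtrancl_into_rtrancl)
qed simp

lemma beta_reaches:
  assumes "\<And>T. T \<in> dom_beta r1 r2 n \<Longrightarrow> (T, beta T) \<in> R"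
    and "(h, q1, q2) \<in> Fam r1 r2 n" "k + 2 \<le> q1"
  shows "((h, q1, q2), (h, q1 - k, q2 + k)) \<in> R\<^sup>*"
  using assms(3)
proof (induction k)
  case (Suc k)
  have "((h, q1 - k, q2 + k), beta (h, q1 - k, q2 + k)) \<in> R"
    using Suc.prems assms(2) by (intro assms(1)) (auto simp: dom_beta_def Fam_def)
  with Suc show ?case by (auto intro: rtrancl_into_rtrancl)
qed simp

lemma gamma_reaches:
  assumes "\<And>T. T \<in> dom_gamma r1 r2 n \<Longrightarrow> (T, gamma T) \<in> R"
    and "(h, q1, q2) \<in> Fam r1 r2 n" "k + 2 \<le> h"
  shows "((h, q1, q2), (h - k, q1, q2 + k)) \<in> R\<^sup>*"
  using assms(3)
proof (induction k)
  case (Suc k)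
  have "((h - k, q1, q2 + k), gamma (h - k, q1, q2 + k)) \<in> R"
    using Suc.prems assms(2) by (intro assms(1)) (auto simp: dom_gamma_def Fam_def)
  with Suc show ?case by (auto intro: rtrancl_into_rtrancl)
qed simp

text \<open>Writing q1 and q2 as 2 plus a surplus removes truncated subtraction: the family equation
  makes n - 1 - 2 * (r1 + r2) at least 6.\<close>

lemma Fam_coordinates:
  assumes "T \<in> Fam r1 r2 n"
  obtains h a b where "T = (h, a + 2, b + 2)" "2 \<le> h"
    "n - 5 - 2 * (r1 + r2) = h + a + b" "n - 1 - 2 * (r1 + r2) = h + a + b + 4"
proof -
  obtain h q1 q2 where T: "T = (h, q1, q2)" by (cases T)
  show thesis
    by (rule that[of h "q1 - 2" "q2 - 2"]) (use assms in \<open>auto simp: T Fam_def\<close>)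
qed

text \<open>First alpha moves the surplus of both legs, a + b edges, into q1; then beta passes b of
  them on to q2.\<close>

lemma step_ab_reaches:
  assumes "T \<in> Fam r1 r2 n"
  shows "((n - 5 - 2 * (r1 + r2), 2, 2), T) \<in> (step_ab r1 r2 n)\<^sup>*"
proof -
  obtain h a b where T: "T = (h, a + 2, b + 2)" "2 \<le> h"
    and n: "n - 5 - 2 * (r1 + r2) = h + a + b" "n - 1 - 2 * (r1 + r2) = h + a + b + 4"
    using Fam_coordinates[OF assms] by blast
  have "((h + a + b, 2, 2), (h + a + b - (a + b), 2 + (a + b), 2)) \<in> (step_ab r1 r2 n)\<^sup>*"
    using T n by (intro alpha_reaches[of r1 r2 n]) (auto simp: step_ab_def Fam_def)
  also have "((h + a + b - (a + b), 2 + (a + b), 2), (h + a + b - (a + b), 2 + (a + b) - b, 2 + b))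
      \<in> (step_ab r1 r2 n)\<^sup>*"
    using T n by (intro beta_reaches[of r1 r2 n]) (auto simp: step_ab_def Fam_def)
  also have "(h + a + b - (a + b), 2 + (a + b) - b, 2 + b) = T"
    by (simp add: T)
  finally show ?thesis unfolding n .
qed

text \<open>Both surpluses are taken directly from the pendant leg, a edges by alpha and b edges by
  gamma.\<close>

lemma step_ag_reaches:
  assumes "T \<in> Fam r1 r2 n"
  shows "((n - 5 - 2 * (r1 + r2), 2, 2), T) \<in> (step_ag r1 r2 n)\<^sup>*"
proof -
  obtain h a b where T: "T = (h, a + 2, b + 2)" "2 \<le> h"
    and n: "n - 5 - 2 * (r1 + r2) = h + a + b" "n - 1 - 2 * (r1 + r2) = h + a + b + 4"
    using Fam_coordinates[OF assms] by blast
  have "((h + a + b, 2, 2), (h + a + b - a, 2 + a, 2)) \<in> (step_ag r1 r2 n)\<^sup>*"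
    using T n by (intro alpha_reaches[of r1 r2 n]) (auto simp: step_ag_def Fam_def)
  also have "((h + a + b - a, 2 + a, 2), (h + a + b - a - b, 2 + a, 2 + b)) \<in> (step_ag r1 r2 n)\<^sup>*"
    using T n by (intro gamma_reaches[of r1 r2 n]) (auto simp: step_ag_def Fam_def)
  also have "(h + a + b - a - b, 2 + a, 2 + b) = T"
    by (simp add: T)
  finally show ?thesis unfolding n .
qed

theorem theorem5p2:
  fixes r1 r2 n :: nat
  assumes "2 \<le> r1" and "r1 < r2"
    and "2 \<le> n - 5 - 2 * (r1 + r2)"
  shows
    "(\<forall>T\<in>dom_alpha r1 r2 n. two_switch (tree r1 r2 T) (tree r1 r2 (alpha T))) \<and>
     (\<forall>T\<in>dom_beta r1 r2 n. two_switch (tree r1 r2 T) (tree r1 r2 (beta T))) \<and>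
     (\<forall>T\<in>dom_gamma r1 r2 n. two_switch (tree r1 r2 T) (tree r1 r2 (gamma T))) \<and>
     (\<forall>T\<in>dom_alpha r1 r2 n. rho (tree r1 r2 (alpha T)) < rho (tree r1 r2 T)) \<and>
     (\<forall>T\<in>dom_beta r1 r2 n. rho (tree r1 r2 (beta T)) < rho (tree r1 r2 T)) \<and>
     (\<forall>T\<in>dom_gamma r1 r2 n. rho (tree r1 r2 (gamma T)) < rho (tree r1 r2 T)) \<and>
     (\<forall>T\<in>Fam r1 r2 n. ((n - 5 - 2 * (r1 + r2), 2, 2), T) \<in> (step_ab r1 r2 n)\<^sup>*) \<and>
     (\<forall>T\<in>Fam r1 r2 n. ((n - 5 - 2 * (r1 + r2), 2, 2), T) \<in> (step_ag r1 r2 n)\<^sup>*)"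
proof (intro conjI ballI)
  fix T
  show "two_switch (tree r1 r2 T) (tree r1 r2 (alpha T))" if "T \<in> dom_alpha r1 r2 n"
    using that two_switch_alpha by (cases T) (auto simp: dom_alpha_def Fam_def)
  show "two_switch (tree r1 r2 T) (tree r1 r2 (beta T))" if "T \<in> dom_beta r1 r2 n"
    using that two_switch_beta by (cases T) (auto simp: dom_beta_def Fam_def)
  show "two_switch (tree r1 r2 T) (tree r1 r2 (gamma T))" if "T \<in> dom_gamma r1 r2 n"
    using that two_switch_gamma by (cases T) (auto simp: dom_gamma_def Fam_def)
  show "rho (tree r1 r2 (alpha T)) < rho (tree r1 r2 T)" if "T \<in> dom_alpha r1 r2 n"
    using that rho_alpha_less[OF assms(1,2)] by (cases T) (auto simp: dom_alpha_def Fam_def)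
  show "rho (tree r1 r2 (beta T)) < rho (tree r1 r2 T)" if "T \<in> dom_beta r1 r2 n"
    using that rho_beta_less[OF assms(1,2)] by (cases T) (auto simp: dom_beta_def Fam_def)
  show "rho (tree r1 r2 (gamma T)) < rho (tree r1 r2 T)" if "T \<in> dom_gamma r1 r2 n"
    using that rho_gamma_less[OF assms(1,2)] by (cases T) (auto simp: dom_gamma_def Fam_def)
qed (rule step_ab_reaches step_ag_reaches, assumption)+

end
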